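(* Let $G$ be a planar graph with maximum degree $\Delta\geq 28$ and let $H$ be a subgraph of $G$ that is a matching (i.e., $H$ consists of vertex-disjoint copies of $K_2$). Then any total-$(\Delta+3)$-coloring of $H$ in $G$ can be extended to a total-$(\Delta+3)$-coloring of $G$.
   Context: All graphs are simple. A total-$k$-coloring of a graph is an assignment of colors from $\{1,\dots,k\}$ to its vertices and edges such that adjacent vertices receive different colors, adjacent edges (edges sharing an endpoint) receive different colors, and no edge receives the same color as either of its endpoints. For a subgraph $H$ of $G$, a total-$k$-coloring $\varphi$ of $H$ is a total-$k$-coloring of $H$ in $G$ if, in addition, $\varphi(u)\neq\varphi(v)$ for all $u,v\in V(H)$ that are adjacent in $G$ (i.e., $\varphi$ is also proper with respect to $G$). Extending $\varphi$ to $G$ means finding a total-$k$-coloring of $G$ that agrees with $\varphi$ on all vertices and edges of $H$. *)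

theory Defs
  imports "HOL-Analysis.Analysis"
begin

definition simple_graph :: "'a set \<Rightarrow> 'a set set \<Rightarrow> bool" where
  "simple_graph V E \<longleftrightarrow> finite V \<and> (\<forall>e\<in>E. e \<subseteq> V \<and> card e = 2)"

definition adj :: "'a set set \<Rightarrow> 'a \<Rightarrow> 'a \<Rightarrow> bool" where
  "adj E u v \<longleftrightarrow> {u, v} \<in> E"

definition degree :: "'a set set \<Rightarrow> 'a \<Rightarrow> nat" where
  "degree E v = card {e \<in> E. v \<in> e}"

definition max_degree :: "'a set \<Rightarrow> 'a set set \<Rightarrow> nat" where
  "max_degree V E = Max (insert 0 (degree E ` V))"

definition planar :: "'a set \<Rightarrow> 'a set set \<Rightarrow> bool" where
  "planar V E \<longleftrightarrow> (\<exists>(pos :: 'a \<Rightarrow> complex) (\<gamma> :: 'a set \<Rightarrow> real \<Rightarrow> complex).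
      inj_on pos V \<and>
      (\<forall>e\<in>E. arc (\<gamma> e) \<and> {pathstart (\<gamma> e), pathfinish (\<gamma> e)} = pos ` e
              \<and> path_image (\<gamma> e) \<inter> pos ` V = pos ` e) \<and>
      (\<forall>e\<in>E. \<forall>e'\<in>E. e \<noteq> e' \<longrightarrow> path_image (\<gamma> e) \<inter> path_image (\<gamma> e') \<subseteq> pos ` (e \<inter> e')))"

definition subgraph :: "'a set \<Rightarrow> 'a set set \<Rightarrow> 'a set \<Rightarrow> 'a set set \<Rightarrow> bool" where
  "subgraph VH EH V E \<longleftrightarrow> VH \<subseteq> V \<and> EH \<subseteq> E \<and> (\<forall>e\<in>EH. e \<subseteq> VH)"

definition is_matching_graph :: "'a set \<Rightarrow> 'a set set \<Rightarrow> bool" where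
  "is_matching_graph VH EH \<longleftrightarrow> (\<forall>v\<in>VH. \<exists>!e. e \<in> EH \<and> v \<in> e)"

definition total_coloring_in ::
  "nat \<Rightarrow> 'a set set \<Rightarrow> 'a set \<Rightarrow> 'a set set \<Rightarrow> ('a \<Rightarrow> nat) \<Rightarrow> ('a set \<Rightarrow> nat) \<Rightarrow> bool" where
  "total_coloring_in k E VH EH fv fe \<longleftrightarrow>
     (\<forall>v\<in>VH. fv v \<in> {1..k}) \<and> (\<forall>e\<in>EH. fe e \<in> {1..k}) \<and>
     (\<forall>u\<in>VH. \<forall>v\<in>VH. adj E u v \<longrightarrow> fv u \<noteq> fv v) \<and>
     (\<forall>e\<in>EH. \<forall>e'\<in>EH. e \<noteq> e' \<and> e \<inter> e' \<noteq> {} \<longrightarrow> fe e \<noteq> fe e') \<and>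
     (\<forall>e\<in>EH. \<forall>v\<in>e. fe e \<noteq> fv v)"

abbreviation total_coloring :: "nat \<Rightarrow> 'a set \<Rightarrow> 'a set set \<Rightarrow> ('a \<Rightarrow> nat) \<Rightarrow> ('a set \<Rightarrow> nat) \<Rightarrow> bool" where
  "total_coloring k V E fv fe \<equiv> total_coloring_in k E V E fv fe"

end

(*
  A vertex outside H sees at most Delta neighbours, so the vertex colouring extends greedily. What
  remains is to colour the edges outside H from lists; the list of uv has size at least
  max(d(u), d(v), 27), where d is the degree in G - E(H), and such lists suffice for planar graphs.
  In a minimal counterexample the end degrees of every edge add up to at least 29, and the edges at
  vertices of degree 2 contain no cycle: such a cycle is even, and can be coloured last, from lists
  of size 2. Hence the set B of vertices of degree at least 15 meets every edge, and its degree sum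
  is at most 6|B| (edges inside B) + 2|B| (edges at vertices of degree 2, a forest) + 6|B| (edges at
  vertices of degree 3 to 14, by the bound 2n for bipartite planar graphs), less than 15|B|.

  The edge bounds 3n and 2n come from Euler's inequality for a drawing by arbitrary arcs. Continuous
  logarithms on compact plane sets, i.e. Borsuk's criterion for separating points, replace the
  Jordan curve theorem: they show that an arc splits a face into at most two, and that a
  nonseparating set of edges is no larger than the set of vertices.
*)
theory Submission
  imports Defs
begin

text \<open>The constants are linked. Of the \<Delta> + 3 colours an edge loses two to its ends and
  at most one per end to a matching edge, so \<Delta> - 1 \<ge> 27 remain. A matching edge at u also
  lowers d(u), which is why the list keeps size at least d(u). An edge uv that is coloured last has
  at most d(u) + d(v) - 2 coloured neighbours, so otherwise d(u) + d(v) \<ge> 27 + 2 = 29 = 14 + 15,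
  whence the threshold 15. The obstacle is that edges are arbitrary arcs. Topology is therefore
  turned into arithmetic of logarithms. Three separated points on the two sides of an arc would give
  two integer obstructions, and two integers always satisfy a nontrivial linear relation. All
  subsets of a nonseparating edge set are cuts, so counting subsets bounds its size. The bounds 3n
  and 2n are not the sharp ones, but they hold for small and disconnected graphs alike, and the
  degree count has room for them.\<close>

section \<open>List colouring of the edges of sparse graphs\<close>

text \<open>For simple graphs these are the forests, without any mention of walks or cycles.\<close>

definition peelable :: "'a set set \<Rightarrow> bool" where
  "peelable X \<longleftrightarrow> (\<forall>Y\<subseteq>X. Y \<noteq> {} \<longrightarrow> (\<exists>e\<in>Y. \<exists>u\<in>e. \<forall>e'\<in>Y. u \<in> e' \<longrightarrow> e' = e))"

lemma peelable_mono: "\<lbrakk>peelable X; Y \<subseteq> X\<rbrakk> \<Longrightarrow> peelable Y"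
  by (auto simp: peelable_def)

text \<open>Deleting the leaf edge \<open>e\<close> also removes its private end \<open>u\<close>
  from the union, so edges and vertices go down together.\<close>

lemma peelable_card_le:
  assumes "finite X" "finite (\<Union>X)" "peelable X"
  shows "card X \<le> card (\<Union>X)"
  using assms
proof (induction X rule: finite_psubset_induct)
  case (psubset X)
  show ?case
  proof (cases "X = {}")
    case False
    then obtain e u where e: "e \<in> X" "u \<in> e" and leaf: "\<And>e'. \<lbrakk>e' \<in> X; u \<in> e'\<rbrakk> \<Longrightarrow> e' = e"
      using psubset.prems(2) unfolding peelable_def by (metis order_refl)
    let ?Y = "X - {e}"
    have sub: "\<Union>?Y \<subseteq> \<Union>X - {u}" using leaf by blast
    have "card ?Y \<le> card (\<Union>?Y)"
      using psubset.IH[of ?Y] psubset.prems e peelable_mono[of X ?Y] finite_subset[OF sub] by auto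
    also have "\<dots> \<le> card (\<Union>X - {u})" using sub psubset.prems by (intro card_mono) auto
    also have "\<dots> = card (\<Union>X) - 1" using e by (intro card_Diff_singleton) auto
    finally have "card X - 1 \<le> card (\<Union>X) - 1" using e by (simp add: card_Diff_singleton)
    moreover have "card (\<Union>X) > 0" using e psubset.prems card_gt_0_iff by blast
    ultimately show ?thesis by linarith
  qed simp
qed

section \<open>Even cycles\<close>

lemma card_2_other:
  assumes "card e = 2" "u \<in> e"
  obtains v where "e = {u, v}" "u \<noteq> v"
  using assms by (metis card_2_iff insert_commute insertE singletonD)

text \<open>If every list contains the next one, inclusion all around the cycle makes the lists
  equal, and by evenness two colours can alternate. This is the 2-choosability of even
  cycles.\<close>

lemma cyclic_coloring:
  fixes L :: "nat \<Rightarrow> 'c set"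
  assumes n: "even n" "n \<ge> 2" and L: "\<And>k. k < n \<Longrightarrow> card (L k) \<ge> 2"
  obtains c where "\<And>k. k < n \<Longrightarrow> c k \<in> L k" "\<And>k. k < n \<Longrightarrow> c k \<noteq> c (Suc k mod n)"
proof (cases "\<forall>k<n. L (Suc k mod n) \<subseteq> L k")
  case True
  have L0: "L k \<subseteq> L 0" if "k < n" for k
    using that
  proof (induction k)
    case (Suc k)
    then show ?case using True[rule_format, of k] by simp
  qed simp
  have last: "L 0 \<subseteq> L k" if "k < n" for k
    using that
  proof (induction "n - Suc k" arbitrary: k)
    case 0
    then have "Suc k = n" by simp
    then show ?case using True 0 by (metis mod_self)
  next
    case (Suc m)
    then have "Suc k < n" by simp
    then have "L 0 \<subseteq> L (Suc k)" using Suc by simp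
    then show ?case using True[rule_format, of k] \<open>Suc k < n\<close> by auto
  qed
  have eq: "L k = L 0" if "k < n" for k using L0 last that by blast
  have "card (L 0) \<ge> 2" using L[of 0] n by simp
  then obtain D where "D \<subseteq> L 0" "card D = 2" by (rule obtain_subset_with_card_n)
  then obtain a b where ab: "a \<in> L 0" "b \<in> L 0" "a \<noteq> b" by (auto simp: card_2_iff)
  show ?thesis
  proof (rule that[of "\<lambda>k. if even k then a else b"])
    show "(if even k then a else b) \<in> L k" if "k < n" for k using eq[OF that] ab by simp
    show "(if even k then a else b) \<noteq> (if even (Suc k mod n) then a else b)" if "k < n" for k
    proof -
      have "even (Suc k mod n) \<longleftrightarrow> odd k" using n by (simp add: dvd_mod_iff)
      then show ?thesis using ab by auto
    qed
  qed
next
  case False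
  \<comment> \<open>Start with a colour missing from the preceding list and go once around.\<close>
  then obtain k y where k: "k < n" and y: "y \<in> L (Suc k mod n)" "y \<notin> L k" by blast
  define s where "s = Suc k mod n"
  define L' where "L' = (\<lambda>i. L ((s + i) mod n))"
  have sn: "s < n" unfolding s_def using n by simp
  have other: "\<exists>z. z \<in> L' i \<and> z \<noteq> u" for i u
  proof (rule ccontr)
    assume "\<not> ?thesis"
    then have "L' i \<subseteq> {u}" by blast
    then have "card (L' i) \<le> 1" using card_mono[of "{u}"] by fastforce
    then show False using L[of "(s + i) mod n"] n by (simp add: L'_def)
  qed
  \<comment> \<open>\<open>d\<close> colours the tour that starts at \<open>s\<close>, each colour
    differing from the one before; only the closing pair remains to be checked.\<close>
  define d where "d = rec_nat y (\<lambda>i u. SOME z. z \<in> L' (Suc i) \<and> z \<noteq> u)"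
  have d0: "d 0 = y" by (simp add: d_def)
  have dS: "d (Suc i) \<in> L' (Suc i) \<and> d (Suc i) \<noteq> d i" for i
  proof -
    have "d (Suc i) = (SOME z. z \<in> L' (Suc i) \<and> z \<noteq> d i)" by (simp add: d_def)
    then show ?thesis using someI_ex[OF other] by simp
  qed
  have dL: "d i \<in> L' i" for i
    by (cases i) (use dS d0 y sn in \<open>auto simp: L'_def s_def\<close>)
  \<comment> \<open>The tour ends at \<open>k\<close>, whose list lacks \<open>y\<close>, so its
    last colour differs from the first.\<close>
  have Lk: "L' (n - 1) = L k"
  proof -
    have "(s + (n - 1)) mod n = k"
    proof (cases "Suc k = n")
      case True then show ?thesis using n by (auto simp: s_def)
    next
      case False
      then have "s + (n - 1) = k + n" using k n by (auto simp: s_def)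
      then show ?thesis using k by simp
    qed
    then show ?thesis by (simp add: L'_def)
  qed
  \<comment> \<open>\<open>r\<close> undoes the rotation: \<open>r j\<close> is the place of
    \<open>j\<close> on the tour from \<open>s\<close>.\<close>
  define r where "r = (\<lambda>j. (j + (n - s)) mod n)"
  have rn: "r j < n" for j using n by (simp add: r_def)
  have sr: "(s + r j) mod n = j" if "j < n" for j
  proof -
    have "(s + r j) mod n = (s + (j + (n - s))) mod n" by (simp add: r_def mod_add_right_eq)
    also have "s + (j + (n - s)) = j + n" using sn by simp
    finally show ?thesis using that by simp
  qed
  have rS: "r (Suc j mod n) = Suc (r j) mod n" for j
    unfolding r_def by (simp add: mod_add_left_eq mod_Suc_eq)
  show ?thesis
  proof (rule that[of "\<lambda>j. d (r j)"])
    show "d (r j) \<in> L j" if "j < n" for j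
      using dL[of "r j"] sr[OF that] by (simp add: L'_def)
    show "d (r j) \<noteq> d (r (Suc j mod n))" if "j < n" for j
    proof (cases "Suc (r j) = n")
      case True
      then have "r j = n - 1" by simp
      then have "d (r j) \<in> L k" using dL Lk by metis
      moreover have "r (Suc j mod n) = 0" using rS True by simp
      ultimately show ?thesis using d0 y by auto
    next
      case False
      then have "r (Suc j mod n) = Suc (r j)" using rS rn[of j] by simp
      then show ?thesis using dS by metis
    qed
  qed
qed

text \<open>In a set \<open>Y\<close> without leaves a walk never has to turn back, so it goes on
  forever and repeats a vertex; a closest repetition closes a cycle. Its length is even because the
  walk alternates between \<open>A\<close> and the rest.\<close>

lemma not_peelable_even_cycle:
  assumes fin: "finite (\<Union>X)" and c2: "\<And>e. e \<in> X \<Longrightarrow> card e = 2"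
    and bip: "\<And>e. e \<in> X \<Longrightarrow> card (e \<inter> A) = 1" and np: "\<not> peelable X"
  obtains n and x :: "nat \<Rightarrow> 'a" where "even n" "n \<ge> 3" "inj_on x {..<n}"
    "\<And>k. k < n \<Longrightarrow> {x k, x (Suc k mod n)} \<in> X"
proof -
  obtain Y where Y: "Y \<subseteq> X" "Y \<noteq> {}" and deg: "\<And>e u. \<lbrakk>e \<in> Y; u \<in> e\<rbrakk> \<Longrightarrow> \<exists>e'\<in>Y. u \<in> e' \<and> e' \<noteq> e"
    using np unfolding peelable_def by meson
  have step: "\<exists>w. {v, w} \<in> Y \<and> w \<noteq> u" if uv: "{u, v} \<in> Y" for u v
  proof -
    obtain e' where e': "e' \<in> Y" "v \<in> e'" "e' \<noteq> {u, v}" using deg[OF uv, of v] by auto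
    then obtain w where "e' = {v, w}" using c2[of e'] Y by (auto simp: card_2_iff)
    then show ?thesis using e' by (metis insert_commute)
  qed
  obtain u0 v0 where uv0: "{u0, v0} \<in> Y" using Y c2 by (metis card_2_iff subsetD equals0I)
  \<comment> \<open>A state holds the previous and the current vertex, so that the next one can be
    chosen different from the previous one.\<close>
  define nxt where "nxt = (\<lambda>p :: 'a \<times> 'a. (snd p, SOME w. {snd p, w} \<in> Y \<and> w \<noteq> fst p))"
  define p where "p = (\<lambda>k. (nxt ^^ k) (u0, v0))"
  define x where "x = (\<lambda>k. fst (p k))"
  have pS: "p (Suc k) = nxt (p k)" for k by (simp add: p_def)
  have xs: "snd (p k) = x (Suc k)" for k by (simp add: x_def pS nxt_def)
  have pe: "{fst (p k), snd (p k)} \<in> Y" for k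
  proof (induction k)
    case 0 then show ?case using uv0 by (simp add: p_def)
  next
    case (Suc k)
    then show ?case using someI_ex[OF step[OF Suc]] by (simp add: pS nxt_def)
  qed
  have xe: "{x k, x (Suc k)} \<in> Y" for k using pe[of k] unfolding xs by (simp add: x_def)
  have x2: "x (Suc (Suc k)) \<noteq> x k" for k
    using someI_ex[OF step[OF pe[of k]]] by (simp add: xs[symmetric]) (simp add: pS nxt_def x_def)
  have x1: "x (Suc k) \<noteq> x k" for k using c2[of "{x k, x (Suc k)}"] xe[of k] Y by auto
  have alt: "x (Suc k) \<in> A \<longleftrightarrow> x k \<notin> A" for k
  proof -
    have "card ({x k, x (Suc k)} \<inter> A) = 1" using bip xe Y by blast
    then show ?thesis using x1[of k] by (cases "x k \<in> A"; cases "x (Suc k) \<in> A") auto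
  qed
  have alt': "x (i + m) \<in> A \<longleftrightarrow> (x i \<in> A \<longleftrightarrow> even m)" for i m
    by (induction m) (auto simp: alt)
  have "range x \<subseteq> \<Union>X" using xe Y by blast
  then have "finite (range x)" using fin finite_subset by blast
  then have "\<not> inj x" using finite_imageD infinite_UNIV_nat by blast
  then obtain i0 j0 where "x i0 = x j0" "i0 < j0" unfolding inj_def by (metis linorder_neqE_nat)
  then have ex: "\<exists>m>0. \<exists>i. x i = x (i + m)" by (intro exI[of _ "j0 - i0"] conjI exI[of _ i0]) auto
  \<comment> \<open>Minimising the gap between equal vertices over all positions makes any
    \<open>n\<close> consecutive vertices distinct.\<close>
  define n where "n = (LEAST m. m > 0 \<and> (\<exists>i. x i = x (i + m)))"
  obtain i where n: "n > 0" and i: "x i = x (i + n)" using LeastI_ex[OF ex] unfolding n_def by blast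
  have least: "x a \<noteq> x (a + m)" if "0 < m" "m < n" for a m
    using not_less_Least[of m] that unfolding n_def by blast
  have "even n" using alt'[of i n] i by auto
  moreover have "n \<noteq> 2" using i x2[of i] by auto
  ultimately have "n \<ge> 3" using n by presburger
  define y where "y = (\<lambda>k. x (i + k))"
  show ?thesis
  proof (rule that[of n y])
    show "inj_on y {..<n}"
    proof (rule linorder_inj_onI)
      fix a b assume "a < b" "a \<in> {..<n}" "b \<in> {..<n}"
      then show "y a \<noteq> y b" using least[of "b - a" "i + a"] by (auto simp: y_def)
    qed auto
    fix k assume k: "k < n"
    have "y (Suc k mod n) = x (Suc (i + k))"
    proof (cases "Suc k = n")
      case True then show ?thesis using i by (auto simp: y_def)
    next
      case False then show ?thesis using k by (simp add: y_def)
    qed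
    then show "{y k, y (Suc k mod n)} \<in> X" using xe[of "i + k"] Y by (auto simp: y_def)
  qed fact+
qed

text \<open>In the second bound, \<open>A\<close> is one side of a bipartition of \<open>X\<close>.\<close>

definition sparse :: "'a set set \<Rightarrow> bool" where
  "sparse E \<longleftrightarrow> (\<forall>X\<subseteq>E. card X \<le> 3 * card (\<Union>X)) \<and>
     (\<forall>X\<subseteq>E. \<forall>A. (\<forall>e\<in>X. card (e \<inter> A) = 1) \<longrightarrow> card X \<le> 2 * card (\<Union>X))"

section \<open>Degree counting in sparse graphs\<close>

lemma sparse_mono: "\<lbrakk>sparse E; X \<subseteq> E\<rbrakk> \<Longrightarrow> sparse X"
  unfolding sparse_def by (meson order_trans)

lemma degree_mono: "\<lbrakk>finite E; X \<subseteq> E\<rbrakk> \<Longrightarrow> degree X v \<le> degree E v"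
  unfolding degree_def by (rule card_mono) auto

lemma sum_degree:
  assumes "finite E" "finite Z"
  shows "(\<Sum>v\<in>Z. degree E v) = (\<Sum>e\<in>E. card (e \<inter> Z))"
proof -
  have "(\<Sum>v\<in>Z. card {e \<in> E. v \<in> e}) = (\<Sum>e\<in>E. card {v \<in> Z. v \<in> e})"
    by (rule sum_multicount_gen) (use assms in auto)
  moreover have "{v \<in> Z. v \<in> e} = e \<inter> Z" for e by auto
  ultimately show ?thesis by (simp add: degree_def)
qed

text \<open>Sparsity bounds the edges at \<open>V2\<close> and at \<open>S3\<close> by small
  multiples of the vertices involved, while each vertex there contributes 2 or at least 3 such
  edges. Hence both sets are small compared with \<open>B\<close>, and too few edges are left to
  give every vertex of \<open>B\<close> degree 15.\<close>

lemma sparse_degree_2_edges_not_peelable: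
  fixes E :: "'a set set"
  assumes fin: "finite E" and c2: "\<And>e. e \<in> E \<Longrightarrow> card e = 2" and sp: "sparse E" and ne: "E \<noteq> {}"
    and heavy: "\<And>u v. \<lbrakk>{u, v} \<in> E; u \<noteq> v\<rbrakk> \<Longrightarrow> degree E u + degree E v \<ge> 29 \<and> degree E u \<ge> 2"
  shows "\<not> peelable {e \<in> E. \<exists>v\<in>e. degree E v = 2}"
proof
  let ?d = "degree E"
  define E2 where "E2 = {e \<in> E. \<exists>v\<in>e. ?d v = 2}"
  assume "peelable {e \<in> E. \<exists>v\<in>e. degree E v = 2}"
  then have p: "peelable E2" by (simp add: E2_def)
  define V where "V = \<Union>E"
  have fV: "finite V" unfolding V_def using fin c2 by (metis card.infinite finite_Union zero_neq_numeral)
  define V2 where "V2 = {v \<in> V. ?d v = 2}"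
  define S3 where "S3 = {v \<in> V. 3 \<le> ?d v \<and> ?d v \<le> 14}"
  define B where "B = {v \<in> V. 15 \<le> ?d v}"
  define E3 where "E3 = {e \<in> E. e \<inter> S3 \<noteq> {}}"
  define EB where "EB = {e \<in> E. e \<subseteq> B}"
  have fins: "finite V2" "finite S3" "finite B" "finite E2" "finite E3" "finite EB"
    using fV fin by (auto simp: V2_def S3_def B_def E2_def E3_def EB_def)
  \<comment> \<open>As 14 + 14 < 29, an end of degree at most 14 has its other end in
    \<open>B\<close>; so no edge has two ends in \<open>V2\<close> or two in
    \<open>S3\<close>.\<close>
  have small: "e \<subseteq> insert s B \<and> e \<inter> V2 = {s} \<inter> V2 \<and> e \<inter> S3 = {s} \<inter> S3 \<and> card (e \<inter> B) = 1"
    if es: "e \<in> E" "s \<in> e" "?d s \<le> 14" for e s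
  proof -
    obtain t where t: "e = {s, t}" "s \<noteq> t" using card_2_other[OF c2[OF es(1)] es(2)] by blast
    then have "?d t \<ge> 15" using heavy[of s t] es by auto
    then have "t \<in> B" "t \<notin> V2" "t \<notin> S3" "s \<notin> B" using es t by (auto simp: B_def V_def V2_def S3_def)
    then show ?thesis using t by auto
  qed
  have c2': "card (e \<inter> V2) = (if e \<in> E2 then 1 else 0)" if "e \<in> E" for e
  proof (cases "e \<in> E2")
    case True
    then obtain s where s: "s \<in> e" "?d s = 2" by (auto simp: E2_def)
    then have "s \<in> V2" using that by (auto simp: V2_def V_def)
    then show ?thesis using small[OF that s(1)] s True by simp
  next
    case False
    then have "e \<inter> V2 = {}" using that by (auto simp: E2_def V2_def)
    then show ?thesis using False by simp
  qed
  have c3: "card (e \<inter> S3) = (if e \<in> E3 then 1 else 0)" if "e \<in> E" for e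
  proof (cases "e \<in> E3")
    case True
    then obtain s where s: "s \<in> e" "s \<in> S3" by (auto simp: E3_def)
    then show ?thesis using small[OF that s(1)] True by (simp add: S3_def)
  next
    case False
    then have "e \<inter> S3 = {}" using that by (auto simp: E3_def)
    then show ?thesis using False by simp
  qed
  have sub: "E2 \<subseteq> E" "E3 \<subseteq> E" "EB \<subseteq> E" by (auto simp: E2_def E3_def EB_def)
  have cardE2: "card E2 = 2 * card V2"
  proof -
    have "(\<Sum>v\<in>V2. ?d v) = (\<Sum>e\<in>E. if e \<in> E2 then 1 else 0)"
      unfolding sum_degree[OF fin fins(1)] by (rule sum.cong) (use c2' in auto)
    also have "\<dots> = card E2" using sub fin by (simp add: sum.If_cases Int_absorb1)
    finally show ?thesis by (simp add: V2_def)
  qed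
  have cardE3: "3 * card S3 \<le> card E3"
  proof -
    have "3 * card S3 = (\<Sum>v\<in>S3. 3)" by simp
    also have "\<dots> \<le> (\<Sum>v\<in>S3. ?d v)" by (rule sum_mono) (simp add: S3_def)
    also have "\<dots> = (\<Sum>e\<in>E. if e \<in> E3 then 1 else 0)"
      unfolding sum_degree[OF fin fins(2)] by (rule sum.cong) (use c3 in auto)
    also have "\<dots> = card E3" using sub fin by (simp add: sum.If_cases Int_absorb1)
    finally show ?thesis .
  qed
  have "card E3 \<le> 2 * card (\<Union>E3)" using sp sub c3 unfolding sparse_def by (metis subsetD)
  also have "card (\<Union>E3) \<le> card (S3 \<union> B)"
  proof (rule card_mono)
    show "\<Union>E3 \<subseteq> S3 \<union> B" using small by (fastforce simp: E3_def S3_def)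
  qed (use fins in auto)
  also have "\<dots> \<le> card S3 + card B" by (rule card_Un_le)
  finally have E3b: "card E3 \<le> 2 * (card S3 + card B)" by simp
  have fUE2: "\<Union>E2 \<subseteq> V2 \<union> B"
  proof
    fix z assume "z \<in> \<Union>E2"
    then obtain e s where "e \<in> E" "z \<in> e" "s \<in> e" "?d s = 2" by (auto simp: E2_def)
    then show "z \<in> V2 \<union> B" using small[of e s] by (auto simp: V2_def V_def)
  qed
  have "card E2 \<le> card (\<Union>E2)" using peelable_card_le p fins fUE2 by (metis finite_Un finite_subset)
  also have "\<dots> \<le> card (V2 \<union> B)" using fUE2 fins by (intro card_mono) auto
  also have "\<dots> \<le> card V2 + card B" by (rule card_Un_le)
  finally have E2b: "card E2 \<le> card V2 + card B" .
  have "card EB \<le> 3 * card (\<Union>EB)" using sp sub unfolding sparse_def by blast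
  also have "card (\<Union>EB) \<le> card B" using fins by (intro card_mono) (auto simp: EB_def)
  finally have EBb: "card EB \<le> 3 * card B" by simp
  have "15 * card B = (\<Sum>v\<in>B. 15)" by simp
  also have "\<dots> \<le> (\<Sum>v\<in>B. ?d v)" by (rule sum_mono) (simp add: B_def)
  also have "\<dots> = (\<Sum>e\<in>E. card (e \<inter> B))" using sum_degree[OF fin fins(3)] .
  also have "\<dots> \<le> (\<Sum>e\<in>E. (if e \<in> EB then 2 else 0) + (if e \<in> E2 then 1 else 0) + (if e \<in> E3 then 1 else 0))"
  proof (rule sum_mono)
    fix e assume e: "e \<in> E"
    show "card (e \<inter> B) \<le> (if e \<in> EB then 2 else 0) + (if e \<in> E2 then 1 else 0) + (if e \<in> E3 then 1 else 0)"
    proof (cases "e \<in> EB")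
      case True
      then have "e \<inter> B = e" by (auto simp: EB_def)
      then show ?thesis using c2[OF e] True by simp
    next
      case False
      then obtain s where s: "s \<in> e" "s \<notin> B" using e by (auto simp: EB_def)
      then have sV: "s \<in> V" and ds: "?d s \<le> 14" using e by (auto simp: V_def B_def)
      obtain t where "e = {s, t}" "s \<noteq> t" using card_2_other[OF c2[OF e] s(1)] by blast
      then have "?d s \<ge> 2" using heavy[of s t] e by auto
      then have "?d s = 2 \<or> s \<in> S3" using sV ds by (auto simp: S3_def)
      then have "e \<in> E2 \<or> e \<in> E3" using s e by (auto simp: E2_def E3_def)
      then show ?thesis using small[OF e s(1) ds] by auto
    qed
  qed
  also have "\<dots> = 2 * card EB + card E2 + card E3"
    using sub fin by (simp add: sum.distrib sum.If_cases Int_absorb1)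
  finally have main: "15 * card B \<le> 2 * card EB + card E2 + card E3" .
  \<comment> \<open>The two counts of \<open>E2\<close> give \<open>card V2 \<le> card B\<close>,
    those of \<open>E3\<close> give \<open>card S3 \<le> 2 * card B\<close>. The right side of
    \<open>main\<close> is then at most 14 times \<open>card B\<close>.\<close>
  moreover have "card E2 \<le> 2 * card B" using cardE2 E2b by linarith
  moreover have "card E3 \<le> 6 * card B" using cardE3 E3b by presburger
  ultimately have "card B = 0" using EBb by linarith
  then have "B = {}" using fins by simp
  obtain e where e: "e \<in> E" using ne by blast
  then obtain u v where uv: "e = {u, v}" "u \<noteq> v" using c2 by (metis card_2_iff)
  then have "u \<in> B \<or> v \<in> B" using heavy[of u v] e by (auto simp: B_def V_def)
  then show False using \<open>B = {}\<close> by blast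
qed

section \<open>Extending list edge colourings\<close>

definition list_edge_coloring :: "'a set set \<Rightarrow> ('a set \<Rightarrow> 'c set) \<Rightarrow> ('a set \<Rightarrow> 'c) \<Rightarrow> bool" where
  "list_edge_coloring E L c \<longleftrightarrow> (\<forall>e\<in>E. c e \<in> L e) \<and> (\<forall>e\<in>E. \<forall>e'\<in>E. e \<noteq> e' \<and> e \<inter> e' \<noteq> {} \<longrightarrow> c e \<noteq> c e')"

lemma list_edge_coloring_Un:
  assumes "list_edge_coloring E L c" "list_edge_coloring C L' c'"
    and "\<And>e. e \<in> C \<Longrightarrow> L' e \<subseteq> L e - c ` {e' \<in> E. e' \<inter> e \<noteq> {}}"
  shows "list_edge_coloring (C \<union> E) L (\<lambda>e. if e \<in> C then c' e else c e)"
proof -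
  have sub: "c' e \<in> L e" "\<And>e'. \<lbrakk>e' \<in> E; e' \<inter> e \<noteq> {}\<rbrakk> \<Longrightarrow> c e' \<noteq> c' e" if "e \<in> C" for e
  proof -
    have "c' e \<in> L' e" using assms(2) that unfolding list_edge_coloring_def by blast
    then have c': "c' e \<in> L e - c ` {e' \<in> E. e' \<inter> e \<noteq> {}}" using assms(3)[OF that] by blast
    then show "c' e \<in> L e" by blast
    show "c e' \<noteq> c' e" if "e' \<in> E" "e' \<inter> e \<noteq> {}" for e' using c' that by force
  qed
  show ?thesis
    unfolding list_edge_coloring_def
  proof (intro conjI ballI impI)
    fix e assume "e \<in> C \<union> E"
    then show "(if e \<in> C then c' e else c e) \<in> L e"
      using sub assms(1) unfolding list_edge_coloring_def by auto
  next
    fix e e' assume ee: "e \<in> C \<union> E" "e' \<in> C \<union> E" "e \<noteq> e' \<and> e \<inter> e' \<noteq> {}"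
    then have "e' \<inter> e \<noteq> {}" by blast
    then show "(if e \<in> C then c' e else c e) \<noteq> (if e' \<in> C then c' e' else c e')"
      using ee sub(2)[of e e'] sub(2)[of e' e] assms(1,2) unfolding list_edge_coloring_def by auto
  qed
qed

lemma card_adjacent_edges_le:
  assumes "finite E" "e = {u, v}"
  shows "card {e' \<in> E. e' \<inter> e \<noteq> {}} \<le> degree E u + degree E v"
proof -
  have "{e' \<in> E. e' \<inter> e \<noteq> {}} = {e' \<in> E. u \<in> e'} \<union> {e' \<in> E. v \<in> e'}" using assms by auto
  then show ?thesis using card_Un_le[of "{e' \<in> E. u \<in> e'}"] by (simp add: degree_def)
qed

lemma degree_Diff:
  assumes "finite E" "C \<subseteq> E"
  shows "degree (E - C) v = degree E v - degree C v"
proof -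
  have "{e \<in> E - C. v \<in> e} = {e \<in> E. v \<in> e} - {e \<in> C. v \<in> e}" by auto
  then show ?thesis using assms card_Diff_subset[of "{e \<in> C. v \<in> e}" "{e \<in> E. v \<in> e}"]
    by (auto simp: degree_def intro: finite_subset)
qed

text \<open>The line graph of a cycle is again a cycle, so \<open>cyclic_coloring\<close> applies
  with the lists \<open>L (f k)\<close>; \<open>n \<ge> 3\<close> keeps the edges \<open>f k\<close>
  distinct. The degree statement tells how many edges at a vertex are set aside with the
  cycle.\<close>

lemma cycle_list_coloring:
  fixes x :: "nat \<Rightarrow> 'a" and L :: "'a set \<Rightarrow> 'c set"
  assumes n: "even n" "n \<ge> 3" and inj: "inj_on x {..<n}"
    and f_def: "\<And>k. f k = {x k, x (Suc k mod n)}"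
    and L: "\<And>k. k < n \<Longrightarrow> card (L (f k)) \<ge> 2"
  shows "\<exists>c. list_edge_coloring (f ` {..<n}) L c"
    and "k < n \<Longrightarrow> degree (f ` {..<n}) (x k) \<ge> 2"
proof -
  have Sn: "Suc k mod n < n" for k using n by simp
  have xx: "x i = x j \<longleftrightarrow> i = j" if "i < n" "j < n" for i j
    using inj that by (auto dest: inj_onD)
  have Sinj: "i = j" if "i < n" "j < n" "Suc i mod n = Suc j mod n" for i j
    using that by (auto simp: mod_Suc split: if_splits)
  have meet: "i = j \<or> i = Suc j mod n \<or> j = Suc i mod n" if "i < n" "j < n" "f i \<inter> f j \<noteq> {}" for i j
  proof -
    have "x i = x j \<or> x i = x (Suc j mod n) \<or> x (Suc i mod n) = x j \<or> x (Suc i mod n) = x (Suc j mod n)"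
      using that(3) by (auto simp: f_def)
    then show ?thesis using xx that Sn Sinj by metis
  qed
  have SS: "Suc (Suc k mod n) mod n \<noteq> k" if "k < n" for k
    using that n by (auto simp: mod_Suc split: if_splits)
  have finj: "i = j" if ij: "i < n" "j < n" "f i = f j" for i j
  proof (rule ccontr)
    assume "i \<noteq> j"
    then have "x i \<noteq> x j" using ij xx by blast
    then have "x i = x (Suc j mod n)" "x j = x (Suc i mod n)"
      using ij(3) unfolding f_def doubleton_eq_iff by metis+
    then have "i = Suc j mod n" "j = Suc i mod n"
      using xx[OF ij(1) Sn[of j]] xx[OF ij(2) Sn[of i]] by blast+
    then have "Suc (Suc i mod n) mod n = i" by metis
    then show False using SS[OF ij(1)] by contradiction
  qed
  then have injf: "inj_on f {..<n}" by (auto intro: inj_onI)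
  obtain c where c: "\<And>k. k < n \<Longrightarrow> c k \<in> L (f k)" "\<And>k. k < n \<Longrightarrow> c k \<noteq> c (Suc k mod n)"
    using cyclic_coloring[of n "\<lambda>k. L (f k)"] n L by auto
  have "list_edge_coloring (f ` {..<n}) L (c \<circ> inv_into {..<n} f)"
    unfolding list_edge_coloring_def
  proof (intro conjI ballI impI)
    show "(c \<circ> inv_into {..<n} f) e \<in> L e" if "e \<in> f ` {..<n}" for e
      using that c(1) by (auto simp: inv_into_f_f[OF injf])
    fix e e' assume "e \<in> f ` {..<n}" "e' \<in> f ` {..<n}" and ee: "e \<noteq> e' \<and> e \<inter> e' \<noteq> {}"
    then obtain i j where ij: "i < n" "j < n" "e = f i" "e' = f j" by auto
    then have "i = Suc j mod n \<or> j = Suc i mod n" using meet[of i j] ee by auto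
    then have "c i \<noteq> c j" using c(2)[OF ij(1)] c(2)[OF ij(2)] by metis
    then show "(c \<circ> inv_into {..<n} f) e \<noteq> (c \<circ> inv_into {..<n} f) e'"
      using ij by (simp add: inv_into_f_f[OF injf])
  qed
  then show "\<exists>c. list_edge_coloring (f ` {..<n}) L c" by blast
  show "degree (f ` {..<n}) (x k) \<ge> 2" if k: "k < n"
  proof -
    obtain j where j: "j < n" "Suc j mod n = k"
    proof (cases k)
      case 0
      then show ?thesis using that[of "n - 1"] n by simp
    next
      case (Suc j)
      then show ?thesis using that[of j] k by simp
    qed
    have "j \<noteq> k" using j k n by (auto simp: mod_Suc split: if_splits)
    then have "f j \<noteq> f k" using finj j k by blast
    moreover have "{f j, f k} \<subseteq> {e \<in> f ` {..<n}. x k \<in> e}" using j k by (auto simp: f_def)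
    then have "card {f j, f k} \<le> degree (f ` {..<n}) (x k)" unfolding degree_def by (intro card_mono) auto
    ultimately show ?thesis by simp
  qed
qed

text \<open>Lists stay and degrees only drop when a set \<open>C\<close> of edges is removed, so
  induction colours \<open>E - C\<close>; the work is to find a \<open>C\<close> that can be
  coloured afterwards.\<close>

lemma sparse_edge_choosable:
  fixes E :: "'a set set" and L :: "'a set \<Rightarrow> 'c set"
  assumes "finite E" "\<And>e. e \<in> E \<Longrightarrow> card e = 2" "sparse E"
    and "\<And>e. e \<in> E \<Longrightarrow> card (L e) \<ge> 27" "\<And>e v. \<lbrakk>e \<in> E; v \<in> e\<rbrakk> \<Longrightarrow> card (L e) \<ge> degree E v"
  shows "\<exists>c. list_edge_coloring E L c"
  using assms
proof (induction E rule: finite_psubset_induct)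
  case (psubset E)
  note c2 = psubset.prems(1) and sp = psubset.prems(2) and L27 = psubset.prems(3) and Ld = psubset.prems(4)
  have fin: "finite E" by fact
  have IH: "\<exists>c. list_edge_coloring (E - C) L c" if "C \<subseteq> E" "C \<noteq> {}" for C
  proof (rule psubset.IH)
    show "degree (E - C) v \<le> card (L e)" if "e \<in> E - C" "v \<in> e" for e v
      using Ld[of e v] degree_mono[OF fin, of "E - C" v] that by auto
  qed (use that c2 L27 sparse_mono[OF sp] in auto)
  \<comment> \<open>A colour is blocked on \<open>e\<close> only by an edge outside \<open>C\<close>
    at \<open>u\<close> or at \<open>v\<close>.\<close>
  have left: "card (L e - c ` {e' \<in> E - C. e' \<inter> e \<noteq> {}}) \<ge> card (L e) - (degree E u - degree C u + (degree E v - degree C v))"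
    if "e \<in> E" "e = {u, v}" "C \<subseteq> E" for e u v C and c :: "'a set \<Rightarrow> 'c"
  proof -
    have fE: "finite (E - C)" using fin by simp
    have "card (c ` {e' \<in> E - C. e' \<inter> e \<noteq> {}}) \<le> card {e' \<in> E - C. e' \<inter> e \<noteq> {}}"
      by (intro card_image_le finite_subset[OF _ fE]) auto
    also have "\<dots> \<le> degree E u - degree C u + (degree E v - degree C v)"
      using card_adjacent_edges_le[OF fE that(2)] degree_Diff[OF fin that(3)] by metis
    finally have "card (c ` {e' \<in> E - C. e' \<inter> e \<noteq> {}}) \<le> degree E u - degree C u + (degree E v - degree C v)" .
    moreover have "card (L e) - card (c ` {e' \<in> E - C. e' \<inter> e \<noteq> {}}) \<le> card (L e - c ` {e' \<in> E - C. e' \<inter> e \<noteq> {}})"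
      by (rule diff_card_le_card_Diff) (intro finite_imageI finite_subset[OF _ fE], auto)
    ultimately show ?thesis by linarith
  qed
  have ext: "\<exists>c. list_edge_coloring E L c"
    if C: "C \<subseteq> E" "C \<noteq> {}" and e: "\<And>c. \<exists>c'. list_edge_coloring C (\<lambda>e. L e - c ` {e' \<in> E - C. e' \<inter> e \<noteq> {}}) c'" for C
  proof -
    obtain c where c: "list_edge_coloring (E - C) L c" using IH[OF C] by blast
    obtain c' where "list_edge_coloring C (\<lambda>e. L e - c ` {e' \<in> E - C. e' \<inter> e \<noteq> {}}) c'" using e by blast
    then have "list_edge_coloring (C \<union> (E - C)) L (\<lambda>e. if e \<in> C then c' e else c e)"
      by (rule list_edge_coloring_Un[OF c]) simp
    moreover have "C \<union> (E - C) = E" using C by blast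
    ultimately show ?thesis by auto
  qed
  show ?case
  \<comment> \<open>Both end degrees count the edge itself, so at most
    \<open>degree E u + degree E v - 2\<close> colours are blocked; the first case says that the
    list has more.\<close>
  proof (cases "\<exists>u v. {u, v} \<in> E \<and> u \<noteq> v \<and> degree E u + degree E v < card (L {u, v}) + 2")
    case True
    then obtain u v where uv: "{u, v} \<in> E" "u \<noteq> v" "degree E u + degree E v < card (L {u, v}) + 2" by blast
    let ?C = "{{u, v}}"
    have d: "degree ?C u = 1" "degree ?C v = 1" by (auto simp: degree_def Collect_conv_if)
    have pos: "degree E u \<ge> 1" "degree E v \<ge> 1"
      using degree_mono[OF fin, of ?C] uv(1) d by (metis empty_subsetI insert_subset)+
    show ?thesis
    proof (rule ext[of ?C])
      fix c :: "'a set \<Rightarrow> 'c"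
      let ?L = "L {u, v} - c ` {e' \<in> E - ?C. e' \<inter> {u, v} \<noteq> {}}"
      have "card ?L \<ge> 1" using left[OF uv(1) refl, of ?C c] uv(1,3) d pos by simp
      then have "?L \<noteq> {}" by (metis card.empty not_one_le_zero)
      then obtain z where "z \<in> ?L" by (auto simp only: ex_in_conv[symmetric])
      then show "\<exists>c'. list_edge_coloring ?C (\<lambda>e. L e - c ` {e' \<in> E - ?C. e' \<inter> e \<noteq> {}}) c'"
        by (intro exI[of _ "\<lambda>_. z"]) (auto simp: list_edge_coloring_def)
    qed (use uv in auto)
  next
    case False
    then have big: "degree E u + degree E v \<ge> card (L {u, v}) + 2" if "{u, v} \<in> E" "u \<noteq> v" for u v
      using that by force
    \<comment> \<open>27 + 2 gives 29, and a list of size at least \<open>degree E v\<close> forces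
      \<open>degree E u \<ge> 2\<close>.\<close>
    have heavy: "degree E u + degree E v \<ge> 29 \<and> degree E u \<ge> 2" if "{u, v} \<in> E" "u \<noteq> v" for u v
      using big[OF that] L27[OF that(1)] Ld[OF that(1), of v] by auto
    let ?E2 = "{e \<in> E. \<exists>v\<in>e. degree E v = 2}" and ?A = "{v. degree E v = 2}"
    show ?thesis
    proof (cases "E = {}")
      case True then show ?thesis by (simp add: list_edge_coloring_def)
    next
      case False
      have np: "\<not> peelable ?E2" using sparse_degree_2_edges_not_peelable[OF fin c2 sp False heavy] .
      have "finite (\<Union>E)" using fin c2 by (metis card.infinite finite_Union zero_neq_numeral)
      then have fU: "finite (\<Union>?E2)" by (rule finite_subset[rotated]) auto
      have other: "degree E v \<ge> 27" if "{u, v} \<in> E" "u \<noteq> v" "degree E u = 2" for u v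
        using heavy[OF that(1,2)] that(3) by simp
      \<comment> \<open>The other end of such an edge has degree at least 27, so the vertices of
        degree 2 form one side of a bipartition.\<close>
      have bip: "card (e \<inter> ?A) = 1" if e: "e \<in> ?E2" for e
      proof -
        obtain u where u: "u \<in> e" "degree E u = 2" "e \<in> E" using e by blast
        then obtain v where v: "e = {u, v}" "u \<noteq> v" using card_2_other[OF c2[OF u(3)] u(1)] by blast
        then have "e \<inter> ?A = {u}" using other[of u v] u by auto
        then show ?thesis by simp
      qed
      obtain n x where n: "even n" "n \<ge> 3" and inj: "inj_on x {..<n}"
        and cyc: "\<And>k. k < n \<Longrightarrow> {x k, x (Suc k mod n)} \<in> ?E2"
        using not_peelable_even_cycle[OF fU _ bip np] c2 by blast
      define f where "f = (\<lambda>k. {x k, x (Suc k mod n)})"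
      let ?C = "f ` {..<n}"
      have CE: "?C \<subseteq> E" using cyc by (auto simp: f_def)
      have deg2: "degree ?C v \<ge> 2" if ev: "e \<in> ?C" "v \<in> e" for e v
      proof -
        obtain i where "i < n" "v = x i \<or> v = x (Suc i mod n)" using ev by (auto simp: f_def)
        moreover have "Suc i mod n < n" using n by simp
        ultimately obtain k where "k < n" "v = x k" by blast
        \<comment> \<open>The two-element list is a dummy: only the degree bound for the cycle is
          wanted here.\<close>
        then show ?thesis
          using cycle_list_coloring(2)[OF n inj, of f "\<lambda>_. {0::nat,1}" k] by (auto simp: f_def)
      qed
      show ?thesis
      proof (rule ext[OF CE])
        show "?C \<noteq> {}" using n by (auto simp: lessThan_empty_iff)
        fix c :: "'a set \<Rightarrow> 'c"
        let ?L = "\<lambda>e. L e - c ` {e' \<in> E - ?C. e' \<inter> e \<noteq> {}}"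
        show "\<exists>c'. list_edge_coloring ?C ?L c'"
        proof (rule cycle_list_coloring(1)[OF n inj])
          show "f k = {x k, x (Suc k mod n)}" for k by (simp add: f_def)
          fix k assume k: "k < n"
          let ?e = "f k"
          have eC: "?e \<in> ?C" using k by blast
          then have eE: "?e \<in> E" using CE by blast
          obtain u where u: "u \<in> ?e" "degree E u = 2" using cyc[OF k] by (auto simp: f_def)
          obtain v where v: "?e = {u, v}" "u \<noteq> v" using card_2_other[OF c2[OF eE] u(1)] by blast
          \<comment> \<open>Off the cycle \<open>u\<close> has no edge and \<open>v\<close> at most
            \<open>degree E v - 2\<close>, while the list has at least \<open>degree E v\<close>
            colours; two remain.\<close>
          have "degree ?C u \<ge> 2" "degree ?C v \<ge> 2" using deg2[OF eC] v by auto
          moreover have "card (L ?e) \<ge> degree E v" "degree E v \<ge> 27"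
            using Ld[OF eE] v other[of u v] eE u by auto
          ultimately show "2 \<le> card (?L ?e)" using left[OF eE v(1) CE, of c] u(2) by linarith
        qed
      qed
    qed
  qed
qed

section \<open>Crosscuts of open plane sets\<close>

text \<open>Otherwise \<open>\<phi>\<close> on \<open>A\<close> and \<open>(x - b) ^ n\<close> elsewhere form a nowhere zero function on the plane, so
  \<open>(x - b) ^ n\<close> has a logarithm on a large circle.\<close>

lemma no_power_extension_bounded_component:
  fixes S :: "complex set" and b :: complex and \<phi> :: "complex \<Rightarrow> complex"
  defines "A \<equiv> connected_component_set (- S) b"
  assumes "compact S" "b \<notin> S" "bounded A" "n > 0"
    and cont: "continuous_on (S \<union> A) \<phi>"
    and nz: "\<And>x. x \<in> S \<union> A \<Longrightarrow> \<phi> x \<noteq> 0"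
    and eq: "\<And>x. x \<in> S \<Longrightarrow> (x - b) ^ n = \<phi> x"
  shows False
proof -
  have "closed S" using assms compact_imp_closed by blast
  have bA: "b \<in> A" using \<open>b \<notin> S\<close> by (simp add: A_def)
  have comp: "A \<in> components (- S)" unfolding A_def using \<open>b \<notin> S\<close> by (simp add: componentsI)
  have "open A" unfolding A_def using \<open>closed S\<close> by (simp add: open_Compl open_connected_component)
  have clSA: "closed (S \<union> A)" using closed_Un_complement_component[OF \<open>closed S\<close> comp] .
  define \<psi> where "\<psi> = (\<lambda>x. if x \<in> S \<union> A then \<phi> x else (x - b) ^ n)"
  have "continuous_on ((S \<union> A) \<union> (- A)) \<psi>"
    unfolding \<psi>_def
    by (rule continuous_on_cases)
       (use clSA cont \<open>open A\<close> eq in \<open>auto intro!: continuous_intros simp: closed_Compl\<close>)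
  then have c\<psi>: "continuous_on UNIV \<psi>" by (simp add: Un_assoc)
  have nz\<psi>: "\<psi> x \<noteq> 0" for x
    using nz bA by (auto simp: \<psi>_def)
  have "bounded (S \<union> A)" using \<open>compact S\<close> \<open>bounded A\<close> by (simp add: compact_imp_bounded)
  then obtain r where r: "r > 0" "S \<union> A \<subseteq> ball b r"
    using bounded_subset_ballD by blast
  obtain h where h: "continuous_on (cball b r) h" "\<And>z. z \<in> cball b r \<Longrightarrow> \<psi> z = exp (h z)"
    using continuous_logarithm_on_cball[of b r \<psi>] c\<psi> nz\<psi> continuous_on_subset by blast
  \<comment> \<open>On the circle \<open>u\<close> is a continuous root of unity, hence a constant
    \<open>w\<close>. So \<open>w * exp (h x / of_nat n)\<close> extends \<open>x - b\<close> from
    the circle to a zero-free function on the disc.\<close>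
  define u where "u = (\<lambda>x. (x - b) / exp (h x / of_nat n))"
  have sph: "sphere b r \<subseteq> cball b r" by auto
  have un: "u x ^ n = 1" if "x \<in> sphere b r" for x
  proof -
    have "x \<notin> S \<union> A" using r that by auto
    then have "(x - b) ^ n = exp (h x)" using h(2)[of x] that by (auto simp: \<psi>_def)
    moreover have "exp (h x / of_nat n) ^ n = exp (h x)"
      using \<open>n > 0\<close> by (simp add: exp_of_nat_mult[symmetric])
    ultimately show ?thesis by (simp add: u_def power_divide)
  qed
  have "u constant_on sphere b r"
  proof (rule continuous_finite_range_constant)
    show "connected (sphere b r)" by (simp add: connected_sphere)
    show "continuous_on (sphere b r) u"
      unfolding u_def by (intro continuous_intros continuous_on_subset[OF h(1) sph]) (use \<open>n > 0\<close> in auto)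
    have "u ` sphere b r \<subseteq> {z. z ^ n = 1}" using un by auto
    then show "finite (u ` sphere b r)"
      using finite_subset finite_roots_unity[of n] \<open>n > 0\<close> by (metis Suc_leI One_nat_def)
  qed
  then obtain w where w: "\<And>x. x \<in> sphere b r \<Longrightarrow> u x = w" by (auto simp: constant_on_def)
  have "b + of_real r \<in> sphere b r" using r by (simp add: dist_norm)
  with un w have "w \<noteq> 0" using \<open>n > 0\<close> by (metis power_0_left zero_neq_one not_gr0)
  define v where "v = (\<lambda>x. w * exp (h x / of_nat n))"
  have v: "v x = x - b" if "x \<in> sphere b r" for x
    using w[OF that] by (simp add: v_def u_def field_simps)
  \<comment> \<open>Radial projection of \<open>v\<close> would retract the disc onto its boundary
    circle.\<close>
  define f where "f = (\<lambda>x. b + of_real r * (v x / of_real (norm (v x))))"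
  have vnz: "v x \<noteq> 0" for x using \<open>w \<noteq> 0\<close> by (simp add: v_def)
  have "sphere b r retract_of cball b r"
    unfolding retract_of_def retraction_def
  proof (intro exI[of _ f] conjI ballI)
    show "continuous_on (cball b r) f"
      unfolding f_def by (intro continuous_intros) (use vnz h(1) \<open>n > 0\<close> in \<open>auto simp: v_def intro!: continuous_intros\<close>)
    show "f \<in> cball b r \<rightarrow> sphere b r"
      using vnz r by (auto simp: f_def dist_norm norm_mult norm_divide)
    show "f x = x" if "x \<in> sphere b r" for x
      using that v[OF that] r by (auto simp: f_def dist_norm norm_minus_commute)
  qed (use sph in auto)
  then show False using no_retraction_cball[of r b] r by simp
qed

text \<open>Points of one component have homotopic Borsuk maps, that is, directions
  \<open>(x - a) / cmod (x - a)\<close>, so the quotient of these maps has a continuous argument.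
  The logarithm of the quotient of moduli supplies the real part.\<close>

lemma log_quotient_same_component:
  fixes a b :: complex
  assumes "compact K" "connected_component (- K) a b"
  obtains g where "continuous_on K g" "\<And>x. x \<in> K \<Longrightarrow> (x - b) / (x - a) = exp (g x)"
proof -
  have nin: "a \<notin> K" "b \<notin> K" using assms(2) connected_component_in by fastforce+
  have "connected_component (- K) b a" using assms(2) by (rule connected_component_sym)
  then obtain g where g: "continuous_on K g"
    "\<And>x. x \<in> K \<Longrightarrow> exp (\<i>* of_real (g x)) = (x - b) /\<^sub>R cmod (x - b) / ((x - a) /\<^sub>R cmod (x - a))"
    using assms(1)
    apply (simp add: Borsuk_maps_homotopic_in_connected_component_eq [symmetric] nin)
    apply (subst (asm) homotopic_circlemaps_divide)
    apply (auto simp: inessential_eq_continuous_logarithm_circle)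
    done
  define h where "h = (\<lambda>x. of_real (ln (cmod (x - b) / cmod (x - a))) + \<i> * of_real (g x))"
  show ?thesis
  proof (rule that[of h])
    show "continuous_on K h" unfolding h_def
      by (intro continuous_intros g) (use nin in auto)
    fix x assume x: "x \<in> K"
    then have ne: "x \<noteq> a" "x \<noteq> b" using nin by auto
    have "exp (h x) = of_real (cmod (x - b) / cmod (x - a)) * ((x - b) /\<^sub>R cmod (x - b) / ((x - a) /\<^sub>R cmod (x - a)))"
      unfolding h_def exp_add g(2)[OF x, symmetric] using ne by (simp add: exp_of_real)
    also have "\<dots> = (x - b) / (x - a)"
      using ne by (simp add: scaleR_conv_of_real field_simps)
    finally show "(x - b) / (x - a) = exp (h x)" by simp
  qed
qed

text \<open>An arc does not separate the plane, so logarithms exist both on \<open>K\<close> and on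
  the arc. Made equal at the start, they can still differ at the finish by a multiple of
  \<open>2 * pi * \<i>\<close>: the integer \<open>n\<close> is the obstruction to gluing
  them.\<close>

lemma log_quotient_crosscut:
  fixes a b :: complex
  assumes "compact K" "arc \<gamma>" and int: "path_image \<gamma> \<inter> K = {pathstart \<gamma>, pathfinish \<gamma>}"
    and "connected_component (- K) a b" "a \<notin> path_image \<gamma>" "b \<notin> path_image \<gamma>"
  obtains g h and n :: int where "continuous_on K g" "continuous_on (path_image \<gamma>) h"
    "\<And>x. x \<in> K \<Longrightarrow> (x - b) / (x - a) = exp (g x)"
    "\<And>x. x \<in> path_image \<gamma> \<Longrightarrow> (x - b) / (x - a) = exp (h x)"
    "h (pathstart \<gamma>) = g (pathstart \<gamma>)"
    "h (pathfinish \<gamma>) = g (pathfinish \<gamma>) + 2 * pi * \<i> * of_int n"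
proof -
  obtain g where g: "continuous_on K g" "\<And>x. x \<in> K \<Longrightarrow> (x - b) / (x - a) = exp (g x)"
    using log_quotient_same_component assms by metis
  have "connected (- path_image \<gamma>)" using assms by (simp add: connected_arc_complement)
  then have "connected_component (- path_image \<gamma>) a b"
    using assms by (simp add: connected_iff_connected_component)
  then obtain h where h: "continuous_on (path_image \<gamma>) h" "\<And>x. x \<in> path_image \<gamma> \<Longrightarrow> (x - b) / (x - a) = exp (h x)"
    using log_quotient_same_component compact_arc_image[OF \<open>arc \<gamma>\<close>] by metis
  let ?p = "pathstart \<gamma>" and ?q = "pathfinish \<gamma>"
  have pq: "?p \<in> K" "?q \<in> K" "?p \<in> path_image \<gamma>" "?q \<in> path_image \<gamma>" using int by auto
  have "exp (g ?p) = exp (h ?p)" using g(2)[of ?p] h(2)[of ?p] pq by simp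
  then have e1: "exp (g ?p - h ?p) = 1" by (simp add: exp_diff)
  define h' where "h' = (\<lambda>x. h x + (g ?p - h ?p))"
  have h': "exp (h' x) = exp (h x)" for x by (simp add: h'_def exp_add e1)
  have "exp (h' ?q) = exp (g ?q)" unfolding h' using g(2)[of ?q] h(2)[of ?q] pq by simp
  then obtain n :: int where "h' ?q = g ?q + (of_int (2 * n) * pi) * \<i>"
    using exp_eq[of "h' ?q" "g ?q"] by auto
  then have "h' ?q = g ?q + 2 * pi * \<i> * of_int n" by (simp add: mult_ac)
  then show ?thesis
    by (intro that[of g h' n])
       (use g h h' in \<open>auto simp: h'_def intro!: continuous_intros\<close>)
qed

text \<open>If the three points were pairwise separated, a product of powers of
  \<open>(x - b) / (x - a)\<close> and \<open>(x - c) / (x - a)\<close> with a logarithm on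
  \<open>?S\<close> could be solved for a positive power of \<open>x - b\<close> or of
  \<open>x - c\<close>. The solution continues without zeros or poles over the bounded component of
  that point, against \<open>no_power_extension_bounded_component\<close>.\<close>

lemma crosscut_bounded_components:
  fixes a b c :: complex
  assumes K: "compact K" "arc \<gamma>" and int: "path_image \<gamma> \<inter> K = {pathstart \<gamma>, pathfinish \<gamma>}"
    and ab: "connected_component (- K) a b" and ac: "connected_component (- K) a c"
    and nin: "a \<notin> path_image \<gamma>" "b \<notin> path_image \<gamma>" "c \<notin> path_image \<gamma>"
    and bb: "bounded (connected_component_set (- (K \<union> path_image \<gamma>)) b)"
    and bc: "bounded (connected_component_set (- (K \<union> path_image \<gamma>)) c)"
  shows "connected_component (- (K \<union> path_image \<gamma>)) a b \<or> connected_component (- (K \<union> path_image \<gamma>)) a c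
         \<or> connected_component (- (K \<union> path_image \<gamma>)) b c"
proof (rule ccontr)
  assume neg: "\<not> ?thesis"
  let ?S = "K \<union> path_image \<gamma>"
  let ?p = "pathstart \<gamma>" and ?q = "pathfinish \<gamma>"
  have cS: "compact ?S" using K by (simp add: compact_Un compact_arc_image)
  have ninS: "a \<notin> ?S" "b \<notin> ?S" "c \<notin> ?S"
    using nin ab ac connected_component_in by fastforce+
  obtain g1 h1 n1 where 1: "continuous_on K g1" "continuous_on (path_image \<gamma>) h1"
    "\<And>x. x \<in> K \<Longrightarrow> (x - b) / (x - a) = exp (g1 x)"
    "\<And>x. x \<in> path_image \<gamma> \<Longrightarrow> (x - b) / (x - a) = exp (h1 x)"
    "h1 ?p = g1 ?p" "h1 ?q = g1 ?q + 2 * pi * \<i> * of_int n1"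
    using log_quotient_crosscut[OF K int ab nin(1,2)] by metis
  obtain g2 h2 n2 where 2: "continuous_on K g2" "continuous_on (path_image \<gamma>) h2"
    "\<And>x. x \<in> K \<Longrightarrow> (x - c) / (x - a) = exp (g2 x)"
    "\<And>x. x \<in> path_image \<gamma> \<Longrightarrow> (x - c) / (x - a) = exp (h2 x)"
    "h2 ?p = g2 ?p" "h2 ?q = g2 ?q + 2 * pi * \<i> * of_int n2"
    using log_quotient_crosscut[OF K int ac nin(1,3)] by metis
  \<comment> \<open>With two points one obstruction \<open>n1\<close> may be nonzero; with three, a nontrivial combination of
    the two obstructions vanishes, and the corresponding product has a logarithm on all of \<open>?S\<close>.\<close>
  obtain i j :: int where ij: "i * n1 + j * n2 = 0" "i \<noteq> 0 \<or> j \<noteq> 0"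
  proof (cases "n1 = 0")
    case True then show ?thesis using that[of 1 0] by simp
  next
    case False then show ?thesis using that[of n2 "- n1"] by simp
  qed
  have glue: "\<exists>G. continuous_on UNIV G \<and> (\<forall>x\<in>?S. exp (G x) = ((x - b) / (x - a)) powi i * ((x - c) / (x - a)) powi j)"
    if ij: "i * n1 + j * n2 = 0" for i j :: int
  proof -
    define G where "G = (\<lambda>x. if x \<in> K then of_int i * g1 x + of_int j * g2 x else of_int i * h1 x + of_int j * h2 x)"
    have q: "of_int i * h1 ?q + of_int j * h2 ?q = of_int i * g1 ?q + of_int j * g2 ?q"
    proof -
      have "of_int i * h1 ?q + of_int j * h2 ?q = of_int i * g1 ?q + of_int j * g2 ?q + 2 * pi * \<i> * of_int (i * n1 + j * n2)"
        by (simp add: 1 2 algebra_simps)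
      then show ?thesis using ij by simp
    qed
    have "continuous_on ?S G"
      unfolding G_def
    proof (rule continuous_on_cases)
      show "\<forall>x. x \<in> K \<and> x \<notin> K \<or> x \<in> path_image \<gamma> \<and> x \<in> K \<longrightarrow>
          of_int i * g1 x + of_int j * g2 x = of_int i * h1 x + of_int j * h2 x"
        using int q 1(5) 2(5) by (auto simp: set_eq_iff)
    qed (use K 1 2 in \<open>auto intro!: continuous_intros simp: compact_imp_closed closed_arc_image\<close>)
    \<comment> \<open>The Tietze extension makes the logarithm available inside the bounded
      component, where \<open>contra\<close> needs it.\<close>
    moreover have "closedin (top_of_set UNIV) ?S" using cS compact_imp_closed by auto
    ultimately obtain G' where G': "continuous_on UNIV G'" "\<And>x. x \<in> ?S \<Longrightarrow> G' x = G x"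
      using Tietze_unbounded[of ?S G UNIV] by blast
    have "exp (G x) = ((x - b) / (x - a)) powi i * ((x - c) / (x - a)) powi j" if "x \<in> ?S" for x
    proof (cases "x \<in> K")
      case True
      then show ?thesis by (simp add: G_def exp_add 1(3) 2(3) exp_power_int mult.commute)
    next
      case False
      then have "x \<in> path_image \<gamma>" using that by auto
      then show ?thesis using False by (simp add: G_def exp_add 1(4) 2(4) exp_power_int mult.commute)
    qed
    then show ?thesis using G' by auto
  qed
  \<comment> \<open>The points are arbitrary here because \<open>b\<close> and \<open>c\<close> are
    exchanged when \<open>i = 0\<close>.\<close>
  have contra: False
    if m: "m > 0" and G: "continuous_on UNIV G"
      and e: "\<And>x. x \<in> ?S \<Longrightarrow> exp (G x) = ((x - b) / (x - a)) powi int m * ((x - c) / (x - a)) powi j"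
      and neg: "\<not> connected_component (- ?S) b a" "\<not> connected_component (- ?S) b c"
      and nin: "a \<notin> ?S" "b \<notin> ?S" "c \<notin> ?S"
      and bd: "bounded (connected_component_set (- ?S) b)"
    for m :: nat and j :: int and G :: "complex \<Rightarrow> complex" and a b c
  proof -
    \<comment> \<open>\<open>\<phi>\<close> is the equation \<open>e\<close> solved for
      \<open>(x - b) ^ m\<close>. Zeros and poles could lie only at \<open>a\<close> and
      \<open>c\<close>, which are outside \<open>?S \<union> ?A\<close>.\<close>
    define \<phi> where "\<phi> = (\<lambda>x. exp (G x) * (x - a) ^ m * ((x - a) / (x - c)) powi j)"
    let ?A = "connected_component_set (- ?S) b"
    have av: "a \<notin> ?S \<union> ?A" "c \<notin> ?S \<union> ?A" using neg nin by auto
    show False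
    proof (rule no_power_extension_bounded_component[OF cS nin(2) bd m])
      show "continuous_on (?S \<union> ?A) \<phi>"
        unfolding \<phi>_def
        by (intro continuous_intros continuous_on_subset[OF G]) (use av in auto)
      show "\<phi> x \<noteq> 0" if "x \<in> ?S \<union> ?A" for x
        using av that by (auto simp: \<phi>_def)
      show "(x - b) ^ m = \<phi> x" if "x \<in> ?S" for x
      proof -
        have "x \<noteq> a" "x \<noteq> c" using that nin by auto
        then show ?thesis unfolding \<phi>_def e[OF that]
          by (simp add: power_int_divide_distrib field_simps)
      qed
    qed
  qed
  have sym: "\<not> connected_component (- ?S) b a" "\<not> connected_component (- ?S) c a"
    "\<not> connected_component (- ?S) b c" "\<not> connected_component (- ?S) c b"
    using neg connected_component_sym by blast+
  have main: False if ij: "i * n1 + j * n2 = 0" "i > 0 \<or> i = 0 \<and> j > 0" for i j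
  proof -
    obtain G where G: "continuous_on UNIV G"
      "\<And>x. x \<in> ?S \<Longrightarrow> exp (G x) = ((x - b) / (x - a)) powi i * ((x - c) / (x - a)) powi j"
      using glue[OF ij(1)] by blast
    from ij(2) show False
    proof
      assume "i > 0"
      then have "i = int (nat i)" "nat i > 0" by auto
      then show False
        using contra[of "nat i" G b a c j] G sym ninS bb by metis
    next
      assume "i = 0 \<and> j > 0"
      then have "j = int (nat j)" "nat j > 0" by auto
      then show False
        using contra[of "nat j" G c a b i] G sym ninS bc by (metis mult.commute)
    qed
  qed
  have "(-i) * n1 + (-j) * n2 = 0" using ij by (simp add: algebra_simps)
  moreover consider "i > 0" | "i < 0" | "i = 0" "j > 0" | "i = 0" "j < 0" using ij by linarith
  ultimately show False using main[of i j] main[of "-i" "-j"] ij by cases auto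
qed

text \<open>A compact plane set leaves only one unbounded component. So either two of the points
  share it, or two of them lie in bounded components and the third serves as the base point of the
  preceding lemma.\<close>

lemma crosscut_at_most_two_components:
  fixes a b c :: complex
  assumes K: "compact K" "arc \<gamma>" and int: "path_image \<gamma> \<inter> K = {pathstart \<gamma>, pathfinish \<gamma>}"
    and ab: "connected_component (- K) a b" and ac: "connected_component (- K) a c"
    and nin: "a \<notin> path_image \<gamma>" "b \<notin> path_image \<gamma>" "c \<notin> path_image \<gamma>"
  shows "connected_component (- (K \<union> path_image \<gamma>)) a b \<or> connected_component (- (K \<union> path_image \<gamma>)) a c
         \<or> connected_component (- (K \<union> path_image \<gamma>)) b c"
proof -
  let ?C = "connected_component (- (K \<union> path_image \<gamma>))"
  have "bounded (K \<union> path_image \<gamma>)" using K by (simp add: compact_imp_bounded compact_arc_image)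
  then have un: "?C x y" if "\<not> bounded (Collect (?C x))" "\<not> bounded (Collect (?C y))" for x y
    using cobounded_unique_unbounded_component[of "- (K \<union> path_image \<gamma>)" x y] that
    by (metis DIM_complex connected_component_eq_empty connected_component_refl_eq double_complement
      mem_Collect_eq order_refl bounded_empty)
  have ba: "connected_component (- K) b a" and bc: "connected_component (- K) b c"
   and ca: "connected_component (- K) c a" and cb: "connected_component (- K) c b"
    using ab ac connected_component_sym connected_component_trans by metis+
  note L = crosscut_bounded_components[OF K int]
  show ?thesis
    using L[OF ab ac nin(1,2,3)] L[OF ba bc nin(2,1,3)] L[OF ca cb nin(3,1,2)] un
      connected_component_sym by metis
qed

section \<open>Euler's inequality for plane drawings\<close>

lemma clopen_face:
  fixes F :: "complex set"
  assumes F: "open F" "F \<noteq> {}" "F \<subseteq> - K" "frontier F \<subseteq> K" and "connected (- K)"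
  shows "F = - K"
proof (rule ccontr)
  assume "F \<noteq> - K"
  then have "- K - F \<noteq> {}" "- K \<inter> F \<noteq> {}" using F by auto
  then have "- K \<inter> frontier F \<noteq> {}" using connected_Int_frontier[OF assms(5)] by blast
  then show False using F by blast
qed

lemma card_le_2_if_no_three:
  assumes "\<And>a b c. \<lbrakk>a \<in> Q; b \<in> Q; c \<in> Q\<rbrakk> \<Longrightarrow> a = b \<or> a = c \<or> b = c"
  shows "finite Q \<and> card Q \<le> 2"
proof (rule ccontr)
  assume "\<not> ?thesis"
  then obtain S where "S \<subseteq> Q" "card S = 3"
    using infinite_arbitrarily_large[of Q 3] obtain_subset_with_card_n[of 3 Q]
    by (metis not_less_eq_eq numeral_2_eq_2 numeral_3_eq_3)
  then obtain x y z where "{x, y, z} \<subseteq> Q" "x \<noteq> y" "y \<noteq> z" "x \<noteq> z" by (auto simp: card_3_iff)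
  then show False using assms[of x y z] by simp
qed

text \<open>Two logarithms of the same function differ by \<open>2 * pi * \<i>\<close> times a
  continuous integer-valued function, which is constant on the interval.\<close>

lemma path_log_increment:
  fixes h :: "real \<Rightarrow> complex" and d :: complex
  assumes "continuous_on {0..1} h" "\<And>t. t \<in> {0..1} \<Longrightarrow> exp (h t) = exp (2 * pi * \<i> * d * of_real t)"
  shows "h 1 - h 0 = 2 * pi * \<i> * d"
proof -
  define f where "f = (\<lambda>t. (h t - 2 * pi * \<i> * d * of_real t) / (2 * pi * \<i>))"
  have int: "\<exists>n::int. f t = of_int n" if t: "t \<in> {0..1}" for t
  proof -
    obtain n :: int where "h t = 2 * pi * \<i> * d * of_real t + (of_int (2 * n) * pi) * \<i>"
      using assms(2)[OF t] exp_eq[of "h t"] by blast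
    then have "f t = of_int n" by (simp add: f_def field_simps)
    then show ?thesis by blast
  qed
  have "f constant_on {0..1}"
  proof (rule continuous_discrete_range_constant)
    show "continuous_on {0..1} f" unfolding f_def by (intro continuous_intros assms) auto
    fix x :: real assume x: "x \<in> {0..1}"
    show "\<exists>e>0. \<forall>y. y \<in> {0..1} \<and> f y \<noteq> f x \<longrightarrow> e \<le> norm (f y - f x)"
    proof (intro exI[of _ 1] conjI allI impI)
      fix y assume y: "y \<in> {0..1} \<and> f y \<noteq> f x"
      obtain m n :: int where mn: "f x = of_int m" "f y = of_int n" using int x y by metis
      then have "norm (f y - f x) = real_of_int \<bar>n - m\<bar>" by (metis norm_of_int of_int_diff of_int_abs)
      moreover have "\<bar>n - m\<bar> \<ge> 1" using mn y by auto
      ultimately show "1 \<le> norm (f y - f x)" by linarith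
    qed simp
  qed auto
  then have "f 1 = f 0" by (auto simp: constant_on_def)
  then show ?thesis by (simp add: f_def field_simps)
qed

text \<open>\<open>W\<close> is a parameter of its own because the bounds are applied to every set
  \<open>X\<close> of edges of a planar graph, with \<open>W\<close> the union of
  \<open>X\<close>.\<close>

locale plane_drawing =
  fixes W :: "'a set" and E :: "'a set set"
    and pos :: "'a \<Rightarrow> complex" and \<gamma> :: "'a set \<Rightarrow> real \<Rightarrow> complex"
  assumes finite_W: "finite W"
    and edge_subset: "e \<in> E \<Longrightarrow> e \<subseteq> W"
    and card_edge: "e \<in> E \<Longrightarrow> card e = 2"
    and inj_pos: "inj_on pos W"
    and arc_edge: "e \<in> E \<Longrightarrow> arc (\<gamma> e)"
    and ends_edge: "e \<in> E \<Longrightarrow> {pathstart (\<gamma> e), pathfinish (\<gamma> e)} = pos ` e"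
    and edge_vertices: "e \<in> E \<Longrightarrow> path_image (\<gamma> e) \<inter> pos ` W = pos ` e"
    and edge_Int: "\<lbrakk>e \<in> E; e' \<in> E; e \<noteq> e'\<rbrakk> \<Longrightarrow> path_image (\<gamma> e) \<inter> path_image (\<gamma> e') \<subseteq> pos ` (e \<inter> e')"
begin

text \<open>All of \<open>W\<close> is included, so that a further edge is a crosscut: an arc
  meeting the drawing in its two ends only.\<close>

definition drawing :: "'a set set \<Rightarrow> complex set" where
  "drawing X = pos ` W \<union> (\<Union>e\<in>X. path_image (\<gamma> e))"

definition open_edge :: "'a set \<Rightarrow> complex set" where
  "open_edge e = path_image (\<gamma> e) - pos ` e"

definition faces :: "'a set set \<Rightarrow> complex set set" where
  "faces X = components (- drawing X)"

text \<open>One frontier point inside the edge suffices, so nothing need be known about how a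
  frontier runs along an arc.\<close>

definition boundary_edges :: "'a set set \<Rightarrow> complex set \<Rightarrow> 'a set set" where
  "boundary_edges X F = {e \<in> X. frontier F \<inter> open_edge e \<noteq> {}}"

section \<open>Faces and their boundary edges\<close>

lemma finite_E: "finite E"
  using finite_W edge_subset by (meson Pow_iff finite_Pow_iff finite_subset subsetI)

lemma finite_sub: "X \<subseteq> E \<Longrightarrow> finite X"
  using finite_E finite_subset by blast

lemma compact_edges: "X \<subseteq> E \<Longrightarrow> compact (\<Union>e\<in>X. path_image (\<gamma> e))"
  using finite_sub arc_edge by (intro compact_UN) (auto simp: compact_arc_image)

lemma compact_drawing: "X \<subseteq> E \<Longrightarrow> compact (drawing X)"
  unfolding drawing_def using finite_W compact_edges
  by (intro compact_Un) (auto simp: finite_imp_compact)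

lemma open_compl_drawing: "X \<subseteq> E \<Longrightarrow> open (- drawing X)"
  by (simp add: open_Compl compact_drawing compact_imp_closed)

lemma drawing_insert: "drawing (insert e X) = drawing X \<union> path_image (\<gamma> e)"
  by (auto simp: drawing_def)

lemma drawing_mono: "X \<subseteq> Y \<Longrightarrow> drawing X \<subseteq> drawing Y"
  by (auto simp: drawing_def)

lemma edge_Int_drawing:
  assumes "X \<subseteq> E" "e \<in> E" "e \<notin> X"
  shows "path_image (\<gamma> e) \<inter> drawing X = pos ` e"
proof -
  have "path_image (\<gamma> e) \<inter> path_image (\<gamma> e') \<subseteq> pos ` e" if "e' \<in> X" for e'
    using edge_Int[of e e'] that assms by blast
  then show ?thesis using edge_vertices[OF assms(2)] unfolding drawing_def by blast
qed

lemma open_edge_disjoint_drawing: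
  assumes "X \<subseteq> E" "e \<in> E" "e \<notin> X"
  shows "open_edge e \<inter> drawing X = {}"
  using edge_Int_drawing[OF assms] by (auto simp: open_edge_def)

lemma open_edge_eq: "e \<in> E \<Longrightarrow> open_edge e = path_image (\<gamma> e) - {pathstart (\<gamma> e), pathfinish (\<gamma> e)}"
  by (simp add: open_edge_def ends_edge)

lemma open_edge_nonempty: "e \<in> E \<Longrightarrow> open_edge e \<noteq> {}"
  using nonempty_simple_path_endless arc_imp_simple_path arc_edge open_edge_eq by metis

lemma connected_open_edge: "e \<in> E \<Longrightarrow> connected (open_edge e)"
  using connected_simple_path_endless arc_imp_simple_path arc_edge open_edge_eq by metis

lemma open_edge_subset_drawing: "e \<in> X \<Longrightarrow> open_edge e \<subseteq> drawing X"
  by (auto simp: open_edge_def drawing_def)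

lemma face_subset: "F \<in> faces X \<Longrightarrow> F \<subseteq> - drawing X"
  unfolding faces_def by (rule in_components_subset)

lemma frontier_face: "\<lbrakk>X \<subseteq> E; F \<in> faces X\<rbrakk> \<Longrightarrow> frontier F \<subseteq> drawing X"
  unfolding faces_def
  by (rule frontier_of_components_closed_complement) (simp_all add: compact_drawing compact_imp_closed)

lemma open_face: "\<lbrakk>X \<subseteq> E; F \<in> faces X\<rbrakk> \<Longrightarrow> open F"
  unfolding faces_def using open_components open_compl_drawing by blast

lemma face_nonempty: "F \<in> faces X \<Longrightarrow> F \<noteq> {}"
  unfolding faces_def by (rule in_components_nonempty)

lemma face_eqI:
  assumes "F \<in> faces X" "F' \<in> faces X" "a \<in> F" "b \<in> F'" "connected_component (- drawing X) a b"
  shows "F = F'"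
proof -
  have "F = connected_component_set (- drawing X) a" "F' = connected_component_set (- drawing X) b"
    using assms components_iff connected_component_eq unfolding faces_def
    by (metis (mono_tags, lifting))+
  then show ?thesis using connected_component_eq assms(5) by (metis mem_Collect_eq)
qed

lemma open_edge_face:
  assumes "X \<subseteq> E" "e \<in> E" "e \<notin> X"
  obtains F where "F \<in> faces X" "open_edge e \<subseteq> F"
    "\<And>A. \<lbrakk>connected A; A \<subseteq> - drawing X; A \<inter> F \<noteq> {}\<rbrakk> \<Longrightarrow> A \<subseteq> F"
proof -
  obtain y where y: "y \<in> open_edge e" using open_edge_nonempty assms by blast
  have sub: "open_edge e \<subseteq> - drawing X" using open_edge_disjoint_drawing[OF assms] by blast
  let ?F = "connected_component_set (- drawing X) y"
  have "?F \<in> faces X" unfolding faces_def using y sub by (intro componentsI) auto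
  moreover have "open_edge e \<subseteq> ?F"
    using connected_component_maximal[OF y connected_open_edge sub] assms by blast
  ultimately show ?thesis
    using components_maximal unfolding faces_def by (intro that[of ?F]) (auto simp: faces_def dest: components_maximal)
qed

text \<open>All faces of \<open>X\<close> that border on \<open>e\<close> lie in the one face of
  \<open>X - {e}\<close> that \<open>e\<close> crosses, and a crosscut splits a face into at most
  two.\<close>

lemma boundary_edge_at_most_two_faces:
  assumes X: "X \<subseteq> E" and e: "e \<in> X"
    and F: "F1 \<in> faces X" "F2 \<in> faces X" "F3 \<in> faces X"
    and be: "e \<in> boundary_edges X F1" "e \<in> boundary_edges X F2" "e \<in> boundary_edges X F3"
  shows "F1 = F2 \<or> F1 = F3 \<or> F2 = F3"
proof -
  define Y where "Y = X - {e}"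
  have Y: "Y \<subseteq> E" "e \<in> E" "e \<notin> Y" "X = insert e Y" using assms by (auto simp: Y_def)
  have D: "drawing X = drawing Y \<union> path_image (\<gamma> e)" by (simp add: Y drawing_insert)
  obtain F0 where F0: "F0 \<in> faces Y" "open_edge e \<subseteq> F0"
    "\<And>A. \<lbrakk>connected A; A \<subseteq> - drawing Y; A \<inter> F0 \<noteq> {}\<rbrakk> \<Longrightarrow> A \<subseteq> F0"
    using open_edge_face[OF Y(1-3)] by metis
  have sub: "F \<subseteq> F0" if F: "F \<in> faces X" and be: "e \<in> boundary_edges X F" for F
  proof (rule F0(3))
    show "connected F" using F in_components_connected unfolding faces_def by blast
    show "F \<subseteq> - drawing Y" using face_subset[OF F] D by blast
    obtain x where x: "x \<in> frontier F" "x \<in> open_edge e" using be by (auto simp: boundary_edges_def)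
    then have "x \<in> F0" "x \<in> closure F" using F0 by (auto simp: frontier_def)
    then show "F \<inter> F0 \<noteq> {}"
      using open_face[OF Y(1) F0(1)] open_Int_closure_eq_empty by blast
  qed
  obtain a b c where abc: "a \<in> F1" "b \<in> F2" "c \<in> F3" using F[THEN face_nonempty] by auto
  have F0c: "connected_component (- drawing Y) x y" if "x \<in> F0" "y \<in> F0" for x y
    using that F0(1) unfolding faces_def
    by (metis connected_component_of_subset connected_iff_connected_component in_components_connected in_components_subset)
  have "connected_component (- drawing X) a b \<or> connected_component (- drawing X) a c \<or> connected_component (- drawing X) b c"
    unfolding D
  proof (rule crosscut_at_most_two_components)
    show "compact (drawing Y)" using compact_drawing Y by blast
    show "arc (\<gamma> e)" using arc_edge Y by blast
    show "path_image (\<gamma> e) \<inter> drawing Y = {pathstart (\<gamma> e), pathfinish (\<gamma> e)}"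
      using edge_Int_drawing[OF Y(1-3)] ends_edge Y by simp
    show "connected_component (- drawing Y) a b" "connected_component (- drawing Y) a c"
      using F0c sub abc F be by blast+
    show "a \<notin> path_image (\<gamma> e)" "b \<notin> path_image (\<gamma> e)" "c \<notin> path_image (\<gamma> e)"
      using abc F face_subset D by blast+
  qed
  then show ?thesis using face_eqI F abc by metis
qed

text \<open>A leaf arc meets the other arcs in at most one point, so by Janiszewski's theorem adding
  it to a nonseparating set creates no separation.\<close>

lemma connected_compl_peelable_edges:
  assumes "X \<subseteq> E" "peelable X"
  shows "connected (- (\<Union>e\<in>X. path_image (\<gamma> e)))"
proof -
  have "finite X" using finite_sub assms by blast
  then show ?thesis using assms
  proof (induction X rule: finite_psubset_induct)
    case (psubset X)
    show ?case
    proof (cases "X = {}")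
      case True then show ?thesis by (simp add: connected_UNIV)
    next
      case False
      then obtain e u where e: "e \<in> X" "u \<in> e" and leaf: "\<And>e'. \<lbrakk>e' \<in> X; u \<in> e'\<rbrakk> \<Longrightarrow> e' = e"
        using psubset.prems(2) unfolding peelable_def by (metis order_refl)
      let ?Y = "X - {e}" and ?D = "\<lambda>X. \<Union>e\<in>X. path_image (\<gamma> e)"
      have eE: "e \<in> E" using e psubset.prems by blast
      obtain v where v: "e = {u, v}" using card_edge[OF eE] e(2) by (auto simp: card_2_iff)
      have conn: "connected (- ?D ?Y)"
        using psubset.IH[of ?Y] psubset.prems peelable_mono[OF psubset.prems(2), of ?Y] e by blast
      have "?D ?Y \<inter> path_image (\<gamma> e) \<subseteq> {pos v}"
      proof -
        have "path_image (\<gamma> e') \<inter> path_image (\<gamma> e) \<subseteq> {pos v}" if "e' \<in> ?Y" for e'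
        proof -
          have "u \<notin> e'" using leaf that by blast
          then have "pos ` (e' \<inter> e) \<subseteq> {pos v}" using v by auto
          then show ?thesis using edge_Int[of e' e] that eE psubset.prems by blast
        qed
        then show ?thesis by blast
      qed
      then have "connected (?D ?Y \<inter> path_image (\<gamma> e))"
        by (metis connected_empty connected_sing subset_singletonD)
      moreover have "connected (- path_image (\<gamma> e))" using arc_edge[OF eE] by (simp add: connected_arc_complement)
      moreover have "compact (?D ?Y)" using compact_edges psubset.prems by blast
      moreover have "closed (path_image (\<gamma> e))" using arc_edge[OF eE] by (simp add: closed_arc_image)
      ultimately have "connected (- (?D ?Y \<union> path_image (\<gamma> e)))"
        using Janiszewski_connected conn by blast
      moreover have "?D ?Y \<union> path_image (\<gamma> e) = ?D X" using e by auto
      ultimately show ?thesis by simp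
    qed
  qed
qed

lemma connected_compl_drawing_peelable:
  assumes "X \<subseteq> E" "peelable X"
  shows "connected (- drawing X)"
proof -
  have "connected (- (\<Union>e\<in>X. path_image (\<gamma> e)) - pos ` W)"
  proof (rule connected_open_delete_finite)
    show "open (- (\<Union>e\<in>X. path_image (\<gamma> e)))"
      using compact_imp_closed[OF compact_edges[OF assms(1)]] by (rule open_Compl)
  qed (use connected_compl_peelable_edges[OF assms] finite_W in auto)
  moreover have "- (\<Union>e\<in>X. path_image (\<gamma> e)) - pos ` W = - drawing X" by (auto simp: drawing_def)
  ultimately show ?thesis by simp
qed

text \<open>A forest does not separate the plane, so a face whose boundary edges formed one would be clopen
  in the complement of the drawing of these edges, hence equal to it.\<close>

lemma not_peelable_boundary_edges:
  assumes X: "X \<subseteq> E" and F: "F \<in> faces X" and np: "\<not> peelable X"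
  shows "\<not> peelable (boundary_edges X F)"
proof
  let ?B = "boundary_edges X F"
  assume p: "peelable ?B"
  have B: "?B \<subseteq> X" by (auto simp: boundary_edges_def)
  then have BE: "?B \<subseteq> E" using X by blast
  have "F = - drawing ?B"
  proof (rule clopen_face)
    show "open F" "F \<noteq> {}" using open_face[OF X F] face_nonempty[OF F] by auto
    show "F \<subseteq> - drawing ?B" using face_subset[OF F] drawing_mono[OF B] by blast
    show "connected (- drawing ?B)" using connected_compl_drawing_peelable[OF BE p] .
    show "frontier F \<subseteq> drawing ?B"
    proof
      fix x assume x: "x \<in> frontier F"
      then have "x \<in> drawing X" using frontier_face[OF X F] by blast
      then consider "x \<in> pos ` W" | e where "e \<in> X" "x \<in> path_image (\<gamma> e)" "x \<notin> pos ` W" by (auto simp: drawing_def)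
      then show "x \<in> drawing ?B"
      proof cases
        case 1 then show ?thesis by (auto simp: drawing_def)
      next
        case 2
        then have "x \<in> open_edge e" using edge_subset X by (fastforce simp: open_edge_def)
        then have "e \<in> ?B" using 2 x by (auto simp: boundary_edges_def)
        then show ?thesis using 2 by (auto simp: drawing_def)
      qed
    qed
  qed
  \<comment> \<open>The forest \<open>?B\<close> would already carry the whole drawing of
    \<open>X\<close>, which leaves no room for a further edge.\<close>
  then have sub: "drawing X \<subseteq> drawing ?B" using face_subset[OF F] by blast
  have "?B = X"
  proof (rule ccontr)
    assume "?B \<noteq> X"
    then obtain e where e: "e \<in> X" "e \<notin> ?B" using B by blast
    then have "open_edge e \<inter> drawing ?B = {}" using open_edge_disjoint_drawing[OF BE] X by blast
    then show False using sub open_edge_subset_drawing[OF e(1)] open_edge_nonempty e X by blast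
  qed
  then show False using p np by simp
qed

text \<open>Every end of an edge of \<open>Y\<close> lies on another edge of \<open>Y\<close>.
  Continuing \<open>{v, a}\<close> at \<open>v\<close> gives \<open>{v, b}\<close>, and continuing
  at \<open>a\<close> and at \<open>b\<close> gives \<open>e3\<close> and \<open>e4\<close>. These
  coincide only in a triangle, which no bipartition allows.\<close>

lemma not_peelable_card:
  assumes X: "X \<subseteq> E" and np: "\<not> peelable X"
  shows "card X \<ge> 3"
    and "(\<And>e. e \<in> X \<Longrightarrow> card (e \<inter> A) = 1) \<Longrightarrow> card X \<ge> 4"
proof -
  obtain Y where Y: "Y \<subseteq> X" "Y \<noteq> {}" and deg: "\<And>e u. \<lbrakk>e \<in> Y; u \<in> e\<rbrakk> \<Longrightarrow> \<exists>e'\<in>Y. u \<in> e' \<and> e' \<noteq> e"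
    using np unfolding peelable_def by meson
  have fX: "finite X" using finite_sub X by blast
  have c2: "card e = 2" if "e \<in> Y" for e using card_edge that X Y by blast
  obtain e where e: "e \<in> Y" using Y by blast
  obtain v a where va: "e = {v, a}" "v \<noteq> a" using c2[OF e] by (auto simp: card_2_iff)
  obtain e2 where e2: "e2 \<in> Y" "v \<in> e2" "e2 \<noteq> e" using deg[OF e, of v] va by auto
  obtain b where b: "e2 = {v, b}" "v \<noteq> b"
    using c2[OF e2(1)] e2(2) by (auto simp: card_2_iff)
  obtain e3 where e3: "e3 \<in> Y" "a \<in> e3" "e3 \<noteq> e" using deg[OF e, of a] va by auto
  obtain e4 where e4: "e4 \<in> Y" "b \<in> e4" "e4 \<noteq> e2" using deg[OF e2(1), of b] b by auto
  have ab: "a \<noteq> b" using e2 va b by auto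
  have n: "e3 \<noteq> e2" "e4 \<noteq> e" using e3 e4 va b ab by auto
  have "{e, e2, e3} \<subseteq> X" using e e2 e3 Y by auto
  moreover have "card {e, e2, e3} = 3" using e2 e3 n by auto
  ultimately show "card X \<ge> 3" using card_mono[OF fX] by metis
  assume bip: "\<And>e. e \<in> X \<Longrightarrow> card (e \<inter> A) = 1"
  have bip2: "x \<in> A \<longleftrightarrow> y \<notin> A" if "{x, y} \<in> Y" "x \<noteq> y" for x y
  proof -
    have "card ({x, y} \<inter> A) = 1" using bip that Y by blast
    then show ?thesis using that by (cases "x \<in> A"; cases "y \<in> A") auto
  qed
  have "e3 \<noteq> e4"
  proof
    assume "e3 = e4"
    then have "e3 = {a, b}" using e3(2) e4(2) c2[OF e3(1)] ab
      by (auto simp: card_2_iff)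
    then show False using bip2[of a b] bip2[of v a] bip2[of v b] e e2 e3 va b ab by auto
  qed
  then have "card {e, e2, e3, e4} = 4" using e2 e3 e4 n by auto
  moreover have "{e, e2, e3, e4} \<subseteq> X" using e e2 e3 e4 Y by auto
  ultimately show "card X \<ge> 4" using card_mono[OF fX] by metis
qed

lemma faces_of_edge:
  assumes "X \<subseteq> E" "e \<in> X"
  shows "finite {F \<in> faces X. e \<in> boundary_edges X F} \<and> card {F \<in> faces X. e \<in> boundary_edges X F} \<le> 2"
  by (rule card_le_2_if_no_three) (use boundary_edge_at_most_two_faces[OF assms] in auto)

text \<open>A forest leaves one face. Otherwise every face has a boundary edge, and each of the
  finitely many edges borders on at most two faces.\<close>

lemma finite_faces:
  assumes "X \<subseteq> E"
  shows "finite (faces X)"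
proof (cases "peelable X")
  case True
  then have "faces X \<subseteq> {- drawing X}"
    using connected_compl_drawing_peelable[OF assms] components_eq_sing_iff components_empty
    unfolding faces_def by (metis empty_subsetI order_refl)
  then show ?thesis using finite_subset by blast
next
  case False
  have "faces X \<subseteq> (\<Union>e\<in>X. {F \<in> faces X. e \<in> boundary_edges X F})"
  proof
    fix F assume F: "F \<in> faces X"
    have "boundary_edges X F \<noteq> {}"
      using not_peelable_boundary_edges[OF assms F False] by (auto simp: peelable_def)
    then show "F \<in> (\<Union>e\<in>X. {F \<in> faces X. e \<in> boundary_edges X F})"
      using F by (auto simp: boundary_edges_def)
  qed
  moreover have "finite (\<Union>e\<in>X. {F \<in> faces X. e \<in> boundary_edges X F})"
    using finite_sub[OF assms] faces_of_edge[OF assms] by blast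
  ultimately show ?thesis using finite_subset by blast
qed

lemma face_edge_count:
  assumes "\<And>F. F \<in> faces E \<Longrightarrow> card (boundary_edges E F) \<ge> k"
  shows "k * card (faces E) \<le> 2 * card E"
proof -
  have "k * card (faces E) = (\<Sum>F\<in>faces E. k)" by simp
  also have "\<dots> \<le> (\<Sum>F\<in>faces E. card {e \<in> E. e \<in> boundary_edges E F})"
  proof (rule sum_mono)
    fix F assume "F \<in> faces E"
    moreover have "{e \<in> E. e \<in> boundary_edges E F} = boundary_edges E F" by (auto simp: boundary_edges_def)
    ultimately show "k \<le> card {e \<in> E. e \<in> boundary_edges E F}" using assms by simp
  qed
  also have "\<dots> = (\<Sum>e\<in>E. card {F \<in> faces E. e \<in> boundary_edges E F})"
    by (rule sum_multicount_gen) (use finite_faces finite_E in auto)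
  also have "\<dots> \<le> (\<Sum>e\<in>E. 2)"
    by (rule sum_mono) (use faces_of_edge in auto)
  finally show ?thesis by simp
qed

text \<open>As \<open>T\<close> does not separate but \<open>insert e T\<close> does, every face of \<open>insert e T\<close> has frontier points on the
  open edge \<open>e\<close>. So the face of \<open>X\<close> crossed by \<open>e\<close> meets at least two of them.\<close>

lemma card_faces_insert:
  assumes T: "T \<subseteq> X" "connected (- drawing T)" "\<not> connected (- drawing (insert e T))"
    and X: "X \<subseteq> E" and e: "e \<in> E" "e \<notin> X"
  shows "card (faces (insert e X)) \<ge> Suc (card (faces X))"
proof -
  let ?X = "insert e X" and ?T = "insert e T"
  have iE: "?X \<subseteq> E" "?T \<subseteq> E" "T \<subseteq> E" "e \<notin> T" using assms by auto
  obtain F0 where F0: "F0 \<in> faces X" "open_edge e \<subseteq> F0"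
    "\<And>A. \<lbrakk>connected A; A \<subseteq> - drawing X; A \<inter> F0 \<noteq> {}\<rbrakk> \<Longrightarrow> A \<subseteq> F0"
    using open_edge_face[OF X e] by metis
  have touch: "A \<inter> F0 \<noteq> {}" if A: "A \<in> faces ?T" for A
  proof -
    have "\<not> frontier A \<subseteq> drawing T"
    proof
      assume "frontier A \<subseteq> drawing T"
      then have "A = - drawing T"
        using open_face[OF iE(2) A] face_nonempty[OF A] face_subset[OF A] drawing_insert T
        by (intro clopen_face) auto
      then show False
        using open_edge_disjoint_drawing[OF iE(3) e(1) iE(4)] face_subset[OF A]
          open_edge_subset_drawing[of e ?T] open_edge_nonempty[OF e(1)] by blast
    qed
    then obtain x where x: "x \<in> frontier A" "x \<notin> drawing T" by blast
    then have "x \<in> path_image (\<gamma> e)" using frontier_face[OF iE(2) A] by (auto simp: drawing_insert)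
    moreover have "x \<notin> pos ` e" using x edge_subset[OF e(1)] by (auto simp: drawing_def)
    ultimately have "x \<in> F0" using F0 by (auto simp: open_edge_def)
    moreover have "x \<in> closure A" using x by (auto simp: frontier_def)
    ultimately show ?thesis using open_face[OF X F0(1)] open_Int_closure_eq_empty by blast
  qed
  \<comment> \<open>Both faces of \<open>?T\<close> reach into \<open>F0\<close>, and points of
    \<open>F0\<close> chosen in them stay separated in the larger drawing of
    \<open>?X\<close>.\<close>
  obtain A B where AB: "A \<in> faces ?T" "B \<in> faces ?T" "A \<noteq> B"
    using T(3) unfolding faces_def
    by (metis connected_empty components_eq_empty connected_eq_connected_components_eq)
  obtain a b where a: "a \<in> A" "a \<in> F0" and b: "b \<in> B" "b \<in> F0" using touch AB by blast
  \<comment> \<open>\<open>up\<close> sends a face of \<open>?X\<close> to the face of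
    \<open>X\<close> around it. It is onto and takes both \<open>A'\<close> and \<open>B'\<close> to
    \<open>F0\<close>, hence the extra face.\<close>
  define up where "up = (\<lambda>F'. SOME F. F \<in> faces X \<and> F' \<subseteq> F)"
  have up: "up F' \<in> faces X \<and> F' \<subseteq> up F'" if F': "F' \<in> faces ?X" for F'
    unfolding up_def
  proof (rule someI_ex)
    have "connected F'" using F' in_components_connected unfolding faces_def by blast
    moreover have "F' \<noteq> {}" "F' \<subseteq> - drawing X"
      using face_nonempty[OF F'] face_subset[OF F'] drawing_insert by auto
    ultimately show "\<exists>F. F \<in> faces X \<and> F' \<subseteq> F"
      unfolding faces_def by (metis exists_component_superset subset_empty)
  qed
  have get: "\<exists>F'\<in>faces ?X. z \<in> F'" if "z \<notin> drawing ?X" for z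
    using that Union_components[of "- drawing ?X"] unfolding faces_def by blast
  have upeq: "up F' = F" if "F' \<in> faces ?X" "F \<in> faces X" "z \<in> F" "z \<in> F'" for F F' z
  proof -
    have "up F' \<in> faces X" "z \<in> up F'" using up that by blast+
    then show ?thesis using that components_eq unfolding faces_def by blast
  qed
  have "a \<notin> drawing ?X" "b \<notin> drawing ?X"
    using a b AB F0(1) face_subset by (fastforce simp: drawing_insert)+
  then obtain A' B' where A': "A' \<in> faces ?X" "a \<in> A'" and B': "B' \<in> faces ?X" "b \<in> B'" using get by meson
  have "A' \<noteq> B'"
  proof
    assume "A' = B'"
    then have "connected_component (- drawing ?X) a b"
      using A' B' unfolding faces_def
      by (metis connected_component_of_subset connected_iff_connected_component in_components_connected in_components_subset)
    then have "connected_component (- drawing ?T) a b"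
      using connected_component_of_subset drawing_mono[of ?T ?X] T(1) by blast
    then show False using face_eqI AB a b by blast
  qed
  moreover have "up A' = F0" "up B' = F0" using upeq A' B' a b F0 by blast+
  ultimately have img: "up ` (faces ?X - {A'}) = up ` faces ?X"
    using A' B' by (auto simp: image_iff)
  have surj: "faces X \<subseteq> up ` faces ?X"
  proof
    fix F assume F: "F \<in> faces X"
    show "F \<in> up ` faces ?X"
    proof (cases "F = F0")
      case True then show ?thesis using \<open>up A' = F0\<close> A' by blast
    next
      case False
      obtain z where z: "z \<in> F" using face_nonempty F by blast
      have "F \<inter> F0 = {}" using False F F0(1) components_eq unfolding faces_def by blast
      moreover have "path_image (\<gamma> e) \<subseteq> drawing X \<union> open_edge e"
        using edge_subset[OF e(1)] by (auto simp: drawing_def open_edge_def)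
      ultimately have "z \<notin> drawing ?X" using z face_subset[OF F] F0(2) drawing_insert by blast
      then obtain F' where "F' \<in> faces ?X" "z \<in> F'" using get by blast
      then show ?thesis using upeq F z by blast
    qed
  qed
  have fin: "finite (faces ?X)" using finite_faces[OF iE(1)] .
  have "card (faces X) \<le> card (up ` (faces ?X - {A'}))"
    using surj img fin by (intro card_mono) auto
  also have "\<dots> \<le> card (faces ?X - {A'})" using fin by (intro card_image_le) auto
  finally have "card (faces X) \<le> card (faces ?X) - 1" using A'(1) fin by simp
  moreover have "card (faces ?X) > 0" using A' fin card_gt_0_iff by blast
  ultimately show ?thesis by linarith
qed

section \<open>Winding along edges, cuts and Euler's inequality\<close>

lemma edge_winding_continuous:
  assumes T: "T \<subseteq> E" and e: "e \<in> T"
  defines "\<zeta> \<equiv> \<lambda>x. if x \<in> path_image (\<gamma> e) then exp (2 * pi * \<i> * of_real (inv_into {0..1} (\<gamma> e) x)) else 1"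
  shows "continuous_on (drawing T) \<zeta>"
    and "x \<in> drawing (T - {e}) \<Longrightarrow> \<zeta> x = 1"
    and "t \<in> {0..1} \<Longrightarrow> \<zeta> (\<gamma> e t) = exp (2 * pi * \<i> * of_real t)"
proof -
  have eE: "e \<in> E" using assms by blast
  have arc: "arc (\<gamma> e)" using arc_edge[OF eE] .
  let ?inv = "inv_into {0..1} (\<gamma> e)"
  have inj: "inj_on (\<gamma> e) {0..1}" using arc arc_def by blast
  have inv: "?inv (\<gamma> e t) = t" if "t \<in> {0..1}" for t using inv_into_f_f[OF inj that] .
  have cinv: "continuous_on (path_image (\<gamma> e)) ?inv"
    unfolding path_image_def
    by (rule continuous_on_inv) (use arc inv in \<open>auto simp: arc_def path_def\<close>)
  show t: "\<zeta> (\<gamma> e t) = exp (2 * pi * \<i> * of_real t)" if "t \<in> {0..1}" for t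
    using inv[OF that] that by (auto simp: \<zeta>_def path_image_def)
  \<comment> \<open>The exponential is 1 at both parameters 0 and 1, so it glues continuously with
    the constant 1 on the rest of the drawing.\<close>
  have ends: "\<zeta> x = 1" if "x \<in> pos ` e" for x
  proof -
    have "x = \<gamma> e 0 \<or> x = \<gamma> e 1" using ends_edge[OF eE] that by (auto simp: pathstart_def pathfinish_def)
    then show ?thesis using t[of 0] t[of 1] by (auto simp: mult_ac)
  qed
  have Te: "T - {e} \<subseteq> E" "e \<notin> T - {e}" using T by auto
  show one: "\<zeta> x = 1" if "x \<in> drawing (T - {e})" for x
    using that ends edge_Int_drawing[OF Te(1) eE Te(2)] unfolding \<zeta>_def by force
  have "continuous_on (path_image (\<gamma> e) \<union> drawing (T - {e})) \<zeta>"
    unfolding \<zeta>_def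
  proof (rule continuous_on_cases)
    show "closed (path_image (\<gamma> e))" using arc by (simp add: closed_arc_image)
    show "closed (drawing (T - {e}))" using compact_drawing[OF Te(1)] compact_imp_closed by blast
    show "continuous_on (path_image (\<gamma> e)) (\<lambda>x. exp (2 * pi * \<i> * of_real (?inv x)))"
      by (intro continuous_intros cinv)
    show "\<forall>x. x \<in> path_image (\<gamma> e) \<and> x \<notin> path_image (\<gamma> e) \<or> x \<in> drawing (T - {e}) \<and> x \<in> path_image (\<gamma> e) \<longrightarrow>
        exp (2 * pi * \<i> * of_real (?inv x)) = 1"
    proof (intro allI impI)
      fix x assume "x \<in> path_image (\<gamma> e) \<and> x \<notin> path_image (\<gamma> e) \<or> x \<in> drawing (T - {e}) \<and> x \<in> path_image (\<gamma> e)"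
      then have "x \<in> drawing (T - {e})" "x \<in> path_image (\<gamma> e)" by auto
      then show "exp (2 * pi * \<i> * of_real (?inv x)) = 1" using one[of x] by (simp add: \<zeta>_def)
    qed
  qed auto
  moreover have "path_image (\<gamma> e) \<union> drawing (T - {e}) = drawing T" using e by (auto simp: drawing_def)
  ultimately show "continuous_on (drawing T) \<zeta>" by simp
qed

text \<open>The map that winds once around the circle along the edges in \<open>w\<close> and is 1 elsewhere has a logarithm,
  since the drawing does not separate the plane; \<open>K\<close> collects the vertices where it is an odd multiple of
  \<open>2 * pi * \<i>\<close>.\<close>

lemma parity_labelling:
  assumes T: "T \<subseteq> E" and conn: "connected (- drawing T)" and w: "w \<subseteq> T"
  shows "\<exists>K\<subseteq>W. w = {e \<in> T. card (e \<inter> K) = 1}"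
proof -
  define z where "z = (\<lambda>e x. if x \<in> path_image (\<gamma> e) then exp (2 * pi * \<i> * of_real (inv_into {0..1} (\<gamma> e) x)) else 1)"
  define \<zeta> where "\<zeta> = (\<lambda>x. \<Prod>e\<in>w. z e x)"
  have fw: "finite w" using finite_sub w T by (meson order_trans)
  have zc: "continuous_on (drawing T) (z e)" "\<And>x. x \<in> drawing (T - {e}) \<Longrightarrow> z e x = 1"
    "\<And>t. t \<in> {0..1} \<Longrightarrow> z e (\<gamma> e t) = exp (2 * pi * \<i> * of_real t)" if "e \<in> T" for e
    using edge_winding_continuous[OF T that] unfolding z_def by blast+
  have "Borsukian (drawing T)" using conn Borsukian_separation_compact compact_drawing[OF T] by blast
  moreover have "continuous_on (drawing T) \<zeta>" unfolding \<zeta>_def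
    by (intro continuous_on_prod zc(1)) (use w in auto)
  moreover have "\<zeta> \<in> drawing T \<rightarrow> - {0}" using fw by (auto simp: \<zeta>_def z_def)
  ultimately obtain h where h: "continuous_on (drawing T) h" "\<And>x. x \<in> drawing T \<Longrightarrow> \<zeta> x = exp (h x)"
    unfolding Borsukian_continuous_logarithm by metis
  define k where "k = (\<lambda>v. SOME k::int. h (pos v) = 2 * pi * \<i> * of_int k)"
  have k: "h (pos v) = 2 * pi * \<i> * of_int (k v)" if "v \<in> W" for v
    unfolding k_def
  proof (rule someI_ex)
    have d: "pos v \<in> drawing X" for X using that by (auto simp: drawing_def)
    have "\<zeta> (pos v) = 1" unfolding \<zeta>_def using zc(2)[OF _ d] w by (intro prod.neutral) auto
    then have "exp (h (pos v)) = exp 0" using h(2)[OF d] by simp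
    then obtain n :: int where "h (pos v) = 0 + (of_int (2 * n) * pi) * \<i>" using exp_eq by blast
    then show "\<exists>k::int. h (pos v) = 2 * pi * \<i> * of_int k" by (intro exI[of _ n]) (simp add: mult_ac)
  qed
  \<comment> \<open>Along \<open>e\<close> all other factors are 1, so the logarithm changes by
    \<open>2 * pi * \<i>\<close> if \<open>e \<in> w\<close> and not at all otherwise.\<close>
  have edge: "e \<in> w \<longleftrightarrow> odd (k u + k v)" if e: "e \<in> T" "e = {u, v}" for e u v
  proof -
    have eE: "e \<in> E" using e T by blast
    define d :: int where "d = (if e \<in> w then 1 else 0)"
    have im: "\<gamma> e ` {0..1} \<subseteq> drawing T" using e by (auto simp: drawing_def path_image_def)
    have \<zeta>e: "\<zeta> (\<gamma> e t) = exp (2 * pi * \<i> * of_int d * of_real t)" if t: "t \<in> {0..1}" for t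
    proof -
      have "z e' (\<gamma> e t) = 1" if "e' \<in> w" "e' \<noteq> e" for e'
      proof (rule zc(2))
        show "e' \<in> T" using that w by blast
        have "e \<in> T - {e'}" using that e by blast
        then show "\<gamma> e t \<in> drawing (T - {e'})" using t unfolding drawing_def path_image_def by blast
      qed
      then have "\<zeta> (\<gamma> e t) = (\<Prod>e'\<in>w. if e' = e then z e (\<gamma> e t) else 1)"
        unfolding \<zeta>_def by (intro prod.cong) auto
      also have "\<dots> = (if e \<in> w then z e (\<gamma> e t) else 1)" using fw by (simp add: prod.delta)
      finally show ?thesis using zc(3)[OF e(1) t] by (simp add: d_def)
    qed
    have "h (\<gamma> e 1) - h (\<gamma> e 0) = 2 * pi * \<i> * of_int d"
    proof (rule path_log_increment)
      show "continuous_on {0..1} (\<lambda>t. h (\<gamma> e t))"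
        using arc_edge[OF eE] im
        by (intro continuous_on_compose2[OF h(1)]) (auto simp: arc_def path_def)
      show "exp (h (\<gamma> e t)) = exp (2 * pi * \<i> * of_int d * of_real t)" if "t \<in> {0..1}" for t
        using \<zeta>e[OF that] h(2) im that by force
    qed
    moreover have "{\<gamma> e 0, \<gamma> e 1} = {pos u, pos v}"
      using ends_edge[OF eE] e(2) by (simp add: pathstart_def pathfinish_def)
    \<comment> \<open>The arc may run from \<open>u\<close> to \<open>v\<close> or back; parity does
      not see the difference.\<close>
    then have "h (\<gamma> e 1) - h (\<gamma> e 0) = h (pos v) - h (pos u) \<or> h (\<gamma> e 1) - h (\<gamma> e 0) = h (pos u) - h (pos v)"
      by (auto simp: doubleton_eq_iff)
    moreover have "u \<in> W" "v \<in> W" using edge_subset[OF eE] e by auto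
    ultimately have "2 * pi * \<i> * of_int (k v - k u) = 2 * pi * \<i> * of_int d \<or> 2 * pi * \<i> * of_int (k u - k v) = 2 * pi * \<i> * of_int d"
      by (auto simp: k right_diff_distrib)
    then have "k v - k u = d \<or> k u - k v = d"
      by (simp only: mult_cancel_left of_int_eq_iff) auto
    then show ?thesis by (cases "e \<in> w") (auto simp: d_def, presburger+)
  qed
  define K where "K = {v \<in> W. odd (k v)}"
  have "e \<in> w \<longleftrightarrow> card (e \<inter> K) = 1" if e: "e \<in> T" for e
  proof -
    have eE: "e \<in> E" using e T by blast
    obtain u v where uv: "e = {u, v}" "u \<noteq> v" using card_edge[OF eE] by (auto simp: card_2_iff)
    have W: "u \<in> W" "v \<in> W" using edge_subset[OF eE] uv by auto
    have "card (e \<inter> K) = (if odd (k u) then 1 else 0) + (if odd (k v) then 1 else 0)"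
      using W uv by (auto simp: K_def)
    then show ?thesis using edge[OF e uv(1)] by auto
  qed
  then have "w = {e \<in> T. card (e \<inter> K) = 1}" using w by blast
  then show ?thesis by (intro exI[of _ K]) (auto simp: K_def)
qed

text \<open>Every subset of \<open>T\<close> is the cut of some \<open>K \<subseteq> W\<close>, so
  \<open>2 ^ card T \<le> 2 ^ card W\<close>. As \<open>K\<close> and \<open>W - K\<close> define
  the same cut, the result is one above the bound for forests; \<open>euler_inequality\<close>
  inherits this loss.\<close>

lemma card_nonseparating:
  assumes "T \<subseteq> E" "connected (- drawing T)"
  shows "card T \<le> card W"
proof -
  have "Pow T \<subseteq> (\<lambda>K. {e \<in> T. card (e \<inter> K) = 1}) ` Pow W"
    using parity_labelling[OF assms] by (auto simp: image_iff)
  then have "card (Pow T) \<le> card (Pow W)"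
    using finite_W by (meson card_image_le card_mono finite_Pow_iff finite_imageI le_trans)
  then show ?thesis using finite_W finite_sub[OF assms(1)] by (simp add: card_Pow)
qed

text \<open>A largest nonseparating edge set \<open>T\<close> takes the place of a spanning forest.
  By maximality every further edge separates together with \<open>T\<close>, hence adds a face to
  the at least one face of \<open>T\<close>.\<close>

lemma euler_inequality: "card E + 1 \<le> card (faces E) + card W"
proof -
  let ?P = "\<lambda>T. T \<subseteq> E \<and> connected (- drawing T)"
  have "?P {}" using connected_compl_drawing_peelable[of "{}"] by (auto simp: peelable_def)
  moreover have "\<And>T. ?P T \<Longrightarrow> card T < Suc (card E)" using card_mono[OF finite_E] by (simp add: less_Suc_eq_le)
  ultimately obtain T where T: "?P T" and max: "\<And>Y. ?P Y \<Longrightarrow> card Y \<le> card T"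
    using ex_has_greatest_nat[of ?P "{}" card "Suc (card E)"] by blast
  have sep: "\<not> connected (- drawing (insert e T))" if "e \<in> E" "e \<notin> T" for e
    using max[of "insert e T"] that T finite_sub[of T] by auto
  have "card (faces (T \<union> Z)) \<ge> Suc (card Z)" if "finite Z" "Z \<subseteq> E" "Z \<inter> T = {}" for Z
    using that
  proof (induction Z rule: finite_induct)
    case empty
    have "bounded (drawing T)" using compact_drawing T compact_imp_bounded by blast
    then have "- drawing T \<noteq> {}" by (metis Compl_empty_eq double_complement not_bounded_UNIV)
    then have "faces T \<noteq> {}" by (simp add: faces_def components_eq_empty)
    then show ?case using finite_faces T by (simp add: Suc_le_eq card_gt_0_iff)
  next
    case (insert e Z)
    have "Suc (card (faces (T \<union> Z))) \<le> card (faces (insert e (T \<union> Z)))"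
      by (rule card_faces_insert[of T]) (use T sep[of e] insert in auto)
    then show ?case using insert by auto
  qed
  from this[of "E - T"] have "card (faces E) \<ge> Suc (card (E - T))"
    using finite_E T by (auto simp: Un_absorb1)
  moreover have "card (E - T) = card E - card T" using T finite_sub by (simp add: card_Diff_subset)
  moreover have "card T \<le> card W" using card_nonseparating T by blast
  ultimately show ?thesis by linarith
qed

text \<open>Counting 3, or in the bipartite case 4, boundary edges per face eliminates the faces
  from Euler's inequality. Forests are treated apart because their single face need not have that
  many boundary edges.\<close>

lemma card_edges_le:
  shows "card E \<le> 3 * card W"
    and "(\<And>e. e \<in> E \<Longrightarrow> card (e \<inter> A) = 1) \<Longrightarrow> card E \<le> 2 * card W"
proof -
  have p: "card E \<le> card W" if "peelable E"
    using card_nonseparating[of E] connected_compl_drawing_peelable[of E] that by blast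
  have sub: "boundary_edges E F \<subseteq> E" for F by (auto simp: boundary_edges_def)
  show "card E \<le> 3 * card W"
  proof (cases "peelable E")
    case False
    have "3 * card (faces E) \<le> 2 * card E"
      by (rule face_edge_count) (use not_peelable_card(1)[OF sub] not_peelable_boundary_edges False in blast)
    then show ?thesis using euler_inequality by linarith
  qed (use p in simp)
  assume bip: "\<And>e. e \<in> E \<Longrightarrow> card (e \<inter> A) = 1"
  show "card E \<le> 2 * card W"
  proof (cases "peelable E")
    case False
    have "4 * card (faces E) \<le> 2 * card E"
    proof (rule face_edge_count)
      fix F assume "F \<in> faces E"
      then have "\<not> peelable (boundary_edges E F)" using not_peelable_boundary_edges False by blast
      then show "4 \<le> card (boundary_edges E F)" using not_peelable_card(2)[OF sub] bip sub by blast
    qed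
    then show ?thesis using euler_inequality by linarith
  qed (use p in simp)
qed

end

section \<open>Extending the colouring of a matching\<close>

text \<open>Each \<open>X \<subseteq> E\<close> is drawn with the vertices of its own edges only, so
  that the bounds speak of \<open>card (\<Union>X)\<close> instead of \<open>card V\<close>.\<close>

lemma planar_imp_sparse:
  assumes "simple_graph V E" "planar V E"
  shows "sparse E"
proof -
  obtain pos :: "'a \<Rightarrow> complex" and \<gamma> :: "'a set \<Rightarrow> real \<Rightarrow> complex" where P: "inj_on pos V \<and>
      (\<forall>e\<in>E. arc (\<gamma> e) \<and> {pathstart (\<gamma> e), pathfinish (\<gamma> e)} = pos ` e
              \<and> path_image (\<gamma> e) \<inter> pos ` V = pos ` e) \<and>
      (\<forall>e\<in>E. \<forall>e'\<in>E. e \<noteq> e' \<longrightarrow> path_image (\<gamma> e) \<inter> path_image (\<gamma> e') \<subseteq> pos ` (e \<inter> e'))"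
    using assms(2) unfolding planar_def by (elim exE)
  note inj = P[THEN conjunct1] and arcs = P[THEN conjunct2, THEN conjunct1, rule_format]
    and disj = P[THEN conjunct2, THEN conjunct2, rule_format]
  have V: "finite V" "\<And>e. e \<in> E \<Longrightarrow> e \<subseteq> V \<and> card e = 2"
    using assms(1) unfolding simple_graph_def by auto
  have draw: "plane_drawing (\<Union>X) X pos \<gamma>" if X: "X \<subseteq> E" for X
  proof
    have UX: "\<Union>X \<subseteq> V" using V X by blast
    show "finite (\<Union>X)" using finite_subset[OF UX V(1)] .
    show "inj_on pos (\<Union>X)" using inj_on_subset[OF inj UX] .
    have restrict: "P \<inter> A = C" if "P \<inter> B = C" "C \<subseteq> A" "A \<subseteq> B" for P A B C :: "complex set"
      using that by blast
    show "path_image (\<gamma> e) \<inter> pos ` \<Union> X = pos ` e" if "e \<in> X" for e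
    proof -
      have "path_image (\<gamma> e) \<inter> pos ` V = pos ` e" using arcs[OF subsetD[OF X that]] by (elim conjE)
      then show ?thesis by (rule restrict) (intro image_mono Union_upper that UX)+
    qed
    fix e assume e: "e \<in> X"
    then have "e \<in> E" using X by blast
    note e = e V(2)[OF this] arcs[OF this]
    show "e \<subseteq> \<Union>X" "card e = 2" "arc (\<gamma> e)" "{pathstart (\<gamma> e), pathfinish (\<gamma> e)} = pos ` e"
      using e by auto
    show "path_image (\<gamma> e) \<inter> path_image (\<gamma> e') \<subseteq> pos ` (e \<inter> e')" if "e' \<in> X" "e \<noteq> e'" for e'
      using disj[of e e'] e(1) that X by blast
  qed
  show ?thesis
    unfolding sparse_def using plane_drawing.card_edges_le[OF draw] by blast
qed

lemma vertex_coloring_extension: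
  assumes "finite V" "finite E" "VH \<subseteq> V" and c2: "\<And>e. e \<in> E \<Longrightarrow> card e = 2"
    and deg: "\<And>v. v \<in> V \<Longrightarrow> degree E v < k"
    and fv: "\<And>v. v \<in> VH \<Longrightarrow> fv v \<in> {1..k}"
    and proper: "\<And>u v. \<lbrakk>u \<in> VH; v \<in> VH; adj E u v\<rbrakk> \<Longrightarrow> fv u \<noteq> fv v"
  shows "\<exists>gv. (\<forall>v\<in>V. gv v \<in> {1..k}) \<and> (\<forall>u\<in>V. \<forall>v\<in>V. adj E u v \<longrightarrow> gv u \<noteq> gv v) \<and> (\<forall>v\<in>VH. gv v = fv v)"
proof -
  have "\<exists>gv. (\<forall>v\<in>VH \<union> Z. gv v \<in> {1..k}) \<and> (\<forall>u\<in>VH \<union> Z. \<forall>v\<in>VH \<union> Z. adj E u v \<longrightarrow> gv u \<noteq> gv v)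
      \<and> (\<forall>v\<in>VH. gv v = fv v)" if "finite Z" "Z \<subseteq> V - VH" for Z
    using that
  proof (induction Z rule: finite_induct)
    case empty
    then show ?case using fv proper by (intro exI[of _ fv]) auto
  next
    case (insert z Z)
    then obtain gv where gv: "\<forall>v\<in>VH \<union> Z. gv v \<in> {1..k}"
      "\<forall>u\<in>VH \<union> Z. \<forall>v\<in>VH \<union> Z. adj E u v \<longrightarrow> gv u \<noteq> gv v" "\<forall>v\<in>VH. gv v = fv v" by auto
    let ?N = "{u. adj E u z}" and ?S = "{e \<in> E. z \<in> e}"
    have inj: "inj_on (\<lambda>u. {u, z}) ?N" by (auto simp: inj_on_def doubleton_eq_iff)
    have im: "(\<lambda>u. {u, z}) ` ?N \<subseteq> ?S" by (auto simp: adj_def)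
    have fS: "finite ?S" using assms(2) by simp
    have "finite ?N" using inj_on_finite[OF inj im fS] .
    then have "card (gv ` ?N) \<le> card ?N" by (rule card_image_le)
    also have "\<dots> \<le> degree E z" unfolding degree_def using card_inj_on_le[OF inj im fS] .
    also have "\<dots> < card {1..k}" using deg insert by simp
    finally have "\<not> {1..k} \<subseteq> gv ` ?N" using card_mono[of "gv ` ?N" "{1..k}"] \<open>finite ?N\<close> by auto
    then obtain c where c: "c \<in> {1..k}" "c \<notin> gv ` ?N" by blast
    have sym: "adj E u v \<longleftrightarrow> adj E v u" for u v by (simp add: adj_def insert_commute)
    have irr: "\<not> adj E v v" for v using c2[of "{v}"] by (auto simp: adj_def)
    have z: "z \<notin> VH \<union> Z" using insert by auto
    have cN: "c \<noteq> gv u" if "adj E u z" for u using c that by blast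
    show ?case
      using gv c z cN sym irr by (intro exI[of _ "gv(z := c)"]) auto
  qed
  from this[of "V - VH"] show ?thesis using assms(1,3) by (simp add: Un_absorb1)
qed

theorem theorem1p4:
  fixes V :: "'a set" and E :: "'a set set" and VH :: "'a set" and EH :: "'a set set"
    and fv :: "'a \<Rightarrow> nat" and fe :: "'a set \<Rightarrow> nat"
  assumes "simple_graph V E" and "planar V E"
    and "max_degree V E \<ge> 28"
    and "subgraph VH EH V E" and "is_matching_graph VH EH"
    and "total_coloring_in (max_degree V E + 3) E VH EH fv fe"
  shows "\<exists>gv ge. total_coloring (max_degree V E + 3) V E gv ge \<and>
                (\<forall>v\<in>VH. gv v = fv v) \<and> (\<forall>e\<in>EH. ge e = fe e)"
proof -
  define \<Delta> where "\<Delta> = max_degree V E"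
  define k where "k = \<Delta> + 3"
  have V: "finite V" "\<And>e. e \<in> E \<Longrightarrow> e \<subseteq> V" and c2: "\<And>e. e \<in> E \<Longrightarrow> card e = 2"
    using assms(1) unfolding simple_graph_def by auto
  have finE: "finite E" by (rule finite_subset[of _ "Pow V"]) (use V in auto)
  have deg: "degree E v \<le> \<Delta>" if "v \<in> V" for v
    unfolding \<Delta>_def max_degree_def using V(1) that by (intro Max_ge) auto
  have VH: "VH \<subseteq> V" "EH \<subseteq> E" "\<And>e. e \<in> EH \<Longrightarrow> e \<subseteq> VH"
    using assms(4) unfolding subgraph_def by auto
  have matching: "\<And>v. v \<in> VH \<Longrightarrow> \<exists>!e. e \<in> EH \<and> v \<in> e"
    using assms(5) unfolding is_matching_graph_def by blast
  note H = assms(6)[unfolded total_coloring_in_def, folded \<Delta>_def, folded k_def]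
  note H = H[THEN conjunct1, rule_format] H[THEN conjunct2, THEN conjunct1, rule_format]
    H[THEN conjunct2, THEN conjunct2, THEN conjunct1, rule_format]
    H[THEN conjunct2, THEN conjunct2, THEN conjunct2, THEN conjunct1, rule_format]
    H[THEN conjunct2, THEN conjunct2, THEN conjunct2, THEN conjunct2, rule_format]
  have "\<exists>gv. (\<forall>v\<in>V. gv v \<in> {1..k}) \<and> (\<forall>u\<in>V. \<forall>v\<in>V. adj E u v \<longrightarrow> gv u \<noteq> gv v) \<and> (\<forall>v\<in>VH. gv v = fv v)"
  proof (rule vertex_coloring_extension[OF V(1) finE VH(1)])
    show "degree E v < k" if "v \<in> V" for v using deg[OF that] by (simp add: k_def)
  qed (fact c2 H(1) H(3))+
  then obtain gv where "\<forall>v\<in>V. gv v \<in> {1..k}" "\<forall>u\<in>V. \<forall>v\<in>V. adj E u v \<longrightarrow> gv u \<noteq> gv v"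
    "\<forall>v\<in>VH. gv v = fv v"
    by (elim exE conjE)
  note gv = this[rule_format]
  define E' where "E' = E - EH"
  define L where "L = (\<lambda>e. {1..k} - (gv ` e \<union> fe ` {m \<in> EH. m \<inter> e \<noteq> {}}))"
  define h :: "'a \<Rightarrow> nat" where "h = (\<lambda>v. degree EH v)"
  have finEH: "finite EH" using finE VH(2) finite_subset by blast
  have h1: "h v \<le> 1" for v
  proof (cases "v \<in> VH")
    case True
    have "a = b" if "a \<in> {e \<in> EH. v \<in> e}" "b \<in> {e \<in> EH. v \<in> e}" for a b
      using ex1_implies_ex matching[OF True] that by (metis mem_Collect_eq)
    then show ?thesis using finEH by (simp add: h_def degree_def card_le_Suc0_iff_eq)
  next
    case False
    then have "{e' \<in> EH. v \<in> e'} = {}" using VH(3) by blast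
    then show ?thesis unfolding h_def degree_def by (metis card.empty zero_le)
  qed
  have dE': "degree E' v + h v \<le> \<Delta>" if "v \<in> V" for v
    using degree_Diff[OF finE VH(2), of v] degree_mono[OF finE VH(2), of v] deg[OF that]
    by (simp add: E'_def h_def)
  \<comment> \<open>The exact counts \<open>h u\<close> and \<open>h v\<close> are kept because in
    the degree bound at an end \<open>w\<close> the loss \<open>h w\<close> is paid for by the
    matching edge missing from \<open>E'\<close>; only the other end uses up the spare
    colour.\<close>
  have cardL: "card (L e) + h u + h v \<ge> \<Delta> + 1" if e: "e \<in> E" "e = {u, v}" for e u v
  proof -
    let ?M = "{m \<in> EH. m \<inter> e \<noteq> {}}"
    have "card (gv ` e \<union> fe ` ?M) \<le> card (gv ` e) + card (fe ` ?M)" by (rule card_Un_le)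
    also have "card (gv ` e) \<le> 2" using c2[OF e(1)] card_image_le[of e gv] e(2) by simp
    also have "card (fe ` ?M) \<le> card ?M" using finEH by (intro card_image_le) auto
    also have "card ?M \<le> h u + h v" unfolding h_def using card_adjacent_edges_le[OF finEH e(2)] .
    finally have "card (gv ` e \<union> fe ` ?M) \<le> 2 + (h u + h v)" by simp
    moreover have "card {1..k} - card (gv ` e \<union> fe ` ?M) \<le> card (L e)"
      unfolding L_def using finEH e(2) by (intro diff_card_le_card_Diff) auto
    ultimately show ?thesis by (simp add: k_def)
  qed
  have "\<exists>c. list_edge_coloring E' L c"
  proof (rule sparse_edge_choosable)
    show "finite E'" using finE by (simp add: E'_def)
    show "sparse E'" using sparse_mono[OF planar_imp_sparse[OF assms(1,2)]] by (auto simp: E'_def)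
    fix e assume "e \<in> E'"
    then have e: "e \<in> E" by (simp add: E'_def)
    then show "card e = 2" by (rule c2)
    obtain u v where uv: "e = {u, v}" using c2[OF e] by (auto simp: card_2_iff)
    show "27 \<le> card (L e)" using cardL[OF e uv] h1[of u] h1[of v] assms(3) by (simp add: \<Delta>_def)
    fix w assume "w \<in> e"
    then obtain w' where w: "e = {w, w'}" using uv by auto
    then have "w \<in> V" using V(2)[OF e] by blast
    then show "degree E' w \<le> card (L e)" using cardL[OF e w] h1[of w'] dE'[of w] by linarith
  qed
  then obtain c where c: "list_edge_coloring E' L c" by blast
  define ge where "ge = (\<lambda>e. if e \<in> EH then fe e else c e)"
  have cL: "c e \<in> {1..k}" "\<And>v. v \<in> e \<Longrightarrow> c e \<noteq> gv v" "\<And>m. \<lbrakk>m \<in> EH; m \<inter> e \<noteq> {}\<rbrakk> \<Longrightarrow> c e \<noteq> fe m"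
    if "e \<in> E" "e \<notin> EH" for e
  proof -
    have "c e \<in> L e" using c that by (simp add: list_edge_coloring_def E'_def)
    then show "c e \<in> {1..k}" "\<And>v. v \<in> e \<Longrightarrow> c e \<noteq> gv v" "\<And>m. \<lbrakk>m \<in> EH; m \<inter> e \<noteq> {}\<rbrakk> \<Longrightarrow> c e \<noteq> fe m"
      unfolding L_def by blast+
  qed
  have cc: "c e \<noteq> c e'" if "e \<in> E" "e \<notin> EH" "e' \<in> E" "e' \<notin> EH" "e \<noteq> e'" "e \<inter> e' \<noteq> {}" for e e'
    using c that by (simp add: list_edge_coloring_def E'_def)
  have "total_coloring k V E gv ge"
    unfolding total_coloring_in_def
  proof (intro conjI ballI impI)
    show "gv v \<in> {1..k}" if "v \<in> V" for v using gv(1) that .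
    show "ge e \<in> {1..k}" if "e \<in> E" for e using H(2) cL(1) that by (simp add: ge_def)
    show "gv u \<noteq> gv v" if "u \<in> V" "v \<in> V" "adj E u v" for u v using gv(2) that .
    show "ge e \<noteq> ge e'" if "e \<in> E" "e' \<in> E" "e \<noteq> e' \<and> e \<inter> e' \<noteq> {}" for e e'
      using that cc[of e e'] H(4)[of e e'] cL(3)[of e e'] cL(3)[of e' e] by (auto simp: ge_def Int_commute)
    show "ge e \<noteq> gv v" if "e \<in> E" "v \<in> e" for e v
    proof (cases "e \<in> EH")
      case True
      then have "v \<in> VH" using VH(3) that by blast
      then show ?thesis using H(5)[OF True that(2)] gv(3) True by (simp add: ge_def)
    next
      case False
      then show ?thesis using cL(2) that by (simp add: ge_def)
    qed
  qed
  then show ?thesis using gv(3) by (intro exI[of _ gv] exI[of _ ge]) (auto simp: k_def \<Delta>_def ge_def)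
qed

end
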